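(* Let $P$ be a closed process, let $(p_i)_{i\in I}$ and $(q_j)_{j\in J}$ be finite families of probability weights (each summing to $1$), and let $\rho_i,\sigma_j$ be density operators on the same space $\mathcal H_\Sigma$ with $\Sigma_P\subseteq\Sigma$. If $\sum_ip_i\rho_i=\sum_jq_j\sigma_j$ then $\sum_ip_i\bullet\overline{\langle\rho_i,P\rangle}\sim_s\sum_jq_j\bullet\overline{\langle\sigma_j,P\rangle}$.
   Context: Notation. $\mathcal D(S)$: finitely supported probability distributions on $S$; $\overline{s}$: point distribution; $\sum_ip_i\bullet\Delta_i$: convex combination; $\Delta_1\oplus_p\Delta_2=p\bullet\Delta_1+(1-p)\bullet\Delta_2$. Qubit names from a denumerable set $\mathcal Q$; $\mathcal H_\Sigma=(\mathbb C^2)^{\otimes|\Sigma|}$; superoperators $\rho\mapsto\sum_iE_i\rho E_i^\dagger$ (trace-preserving if $\sum E_i^\dagger E_i=\mathbb I$); measurements $\mathbb M=\{M_m\}$ with $\sum M_m^\dagger M_m=\mathbb I$, $\mathcal M_m(\sigma)=M_m\sigma M_m^\dagger$; $\mathcal E^{\tilde q}$ applies $\mathcal E$ to qubits $\tilde q$ and the identity elsewhere. Syntax (tagged lqCCS): tags $t\in\mathit{Tag}$; channels typed $\widehat{\mathbb N},\widehat{\mathbb B},\widehat{\mathcal Q}$; $P::=t:\tau.P\mid (t,t'):\tau.P\mid t:\mathcal E(\tilde e).P\mid t:\mathbb M(\tilde e\rhd x).P\mid t:c?x.P\mid \mathbf 0_{\tilde e}\mid t:c!e.P\mid \mathrm{if}\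 e\ \mathrm{then}\ P\ \mathrm{else}\ P\mid P+P\mid P\parallel P\mid P\setminus c$; expressions $e::=x\mid b\mid n\mid q\mid\neg e\mid e\lor e\mid e\le e\mid e=e$, evaluated by $e\Downarrow v$. Typing: $\Sigma\vdash\mathbf 0_{\tilde e}$ if $\tilde e$ enumerates $\Sigma$; prefixes $\tau$, classical send/receive, superoperator and measurement on $\tilde e$ (enumerating a subset of $\Sigma$ of the right size), restriction keep $\Sigma$; sum and if-then-else need both branches typed by $\Sigma$; quantum receive $\Sigma\vdash t:c?x.P$ if $\Sigma\cup\{x\}\vdash P$; quantum send $\Sigma\vdash t:c!e.P$ if $e\in\Sigma$, $\Sigma\setminus\{e\}\vdash P$; $\Sigma_1\cup\Sigma_2\vdash P_1\parallel P_2$ if $\Sigma_1\cap\Sigma_2=\emptyset$, $\Sigma_i\vdash P_i$. Unique typing $\Sigma_P$. Configurations $\langle\rho,P\rangle$ ($\rho$ density operator on $\mathcal H_{\Sigma_\rho}$, $P$ closed), typed $(\Sigma_\rho,\Sigma_P)$ when $\Sigma_P\subseteq\Sigma_\rho$; $\mathit{Conf}_\bot=\mathit{Conf}\cup\{\bot\}$, $\bot$ typed by every pair; distributions typed if all support elements are. Only well-typed distributions are considered. Mass $|\Delta|=1-\Delta(\bot)$. Semantics: schedulers $s::=h\mid t\mid(t,t')$; actions $\tau,c!v,c?v$; transitions $\langle\rho,P\rangle\xrightarrow{\mu}_s\Delta$: least relation with $\langle\rho,t:\tau.P\rangle\xrightarrow{\tau}_t\overline{\langle\rho,P\rangle}$;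 $\langle\rho,(t,t'):\tau.P\rangle\xrightarrow{\tau}_{(t,t')}\overline{\langle\rho,P\rangle}$; $\langle\rho,t:c!e.P\rangle\xrightarrow{c!v}_t\overline{\langle\rho,P\rangle}$ if $e\Downarrow v$; $\langle\rho,t:c?x.P\rangle\xrightarrow{c?v}_t\overline{\langle\rho,P[v/x]\rangle}$ ($v\in\Sigma_\rho$ if quantum); $\langle\rho,t:\mathcal E(\tilde q).P\rangle\xrightarrow{\tau}_t\overline{\langle\mathcal E^{\tilde q}(\rho),P\rangle}$; $\langle\rho,t:\mathbb M(\tilde q\rhd y).P\rangle\xrightarrow{\tau}_t\sum_mp_m\bullet\overline{\langle\mathcal M^{\tilde q}_m(\rho)/p_m,P[m/y]\rangle}$, $p_m=\mathrm{tr}(\mathcal M^{\tilde q}_m(\rho))$; if-then-else follows the branch selected by $e$; $P+Q$ has the transitions of both; restriction passes actions other than $c!v,c?v$; $\langle\rho,P\parallel Q\rangle\xrightarrow{\mu}_s\Delta\parallel Q$ if $\langle\rho,P\rangle\xrightarrow{\mu}_s\Delta$ and $\mu$ is not $c?v$ with $v\in\Sigma_Q$ (and symmetrically); if $\langle\rho,P\rangle\xrightarrow{c!v}_t\overline{\langle\rho,P'\rangle}$, $\langle\rho,Q\rangle\xrightarrow{c?v}_{t'}\overline{\langle\rho,Q'\rangle}$ then $\langle\rho,P\parallel Q\rangle\xrightarrow{\tau}_{(t,t')}\overline{\langle\rho,P'\parallel Q'\rangle}$ and $\langle\rho,Q\parallel P\rangle\xrightarrow{\tau}_{(t,t')}\overline{\langle\rho,Q'\parallel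 P'\rangle}$. Lifting: on $\mathit{Conf}_\bot$, $\mathcal C\xrightarrow{\mu}_s\overline\bot$ is added whenever $\mathcal C$ (including $\bot$) has no $\xrightarrow{\mu}_s$ transition. For $\delta=\sum_jr_j\bullet\overline{s_j}$, $\mathcal C\xrightarrow{\mu}_\delta\sum_jr_j\bullet\Theta_j$ whenever $\mathcal C\xrightarrow{\mu}_{s_j}\Theta_j$ for all $j$; for $\Delta=\sum_ip_i\bullet\overline{\mathcal C_i}$, $\Delta\xrightarrow{\mu}_\delta\sum_ip_i\bullet\Delta_i$ whenever $\mathcal C_i\xrightarrow{\mu}_\delta\Delta_i$ for all $i$. Standing assumption: deterministic tagging, i.e. $\Delta\xrightarrow{\mu}_\delta\Delta'$ and $\Delta\xrightarrow{\mu}_\delta\Delta''$ imply $\Delta'=\Delta''$. Contexts: $B[\cdot]_\Sigma=[\cdot]_\Sigma\parallel Q$, typed $\Sigma'\vdash B[\cdot]_\Sigma$ if $\Sigma\subseteq\Sigma'$ and $\Sigma'\setminus\Sigma\vdash Q$; $B[\langle\rho,P\rangle]=\langle\rho,P\parallel Q\rangle$, defined when $\Sigma_P=\Sigma$ and $\Sigma'\subseteq\Sigma_\rho$; $B[\bot]=\bot$; extended pointwise to distributions. Saturated bisimilarity: $\mathcal R$ is a saturated bisimulation if $\Delta\mathcal R\Theta$ implies: both typed by the same $(\Sigma,\Sigma')$; $|\Delta|=|\Theta|$; for every context $B[\cdot]_{\Sigma'}$ and distribution of schedulers $\delta$, if $B[\Delta]\xrightarrow{\tau}_\delta\Delta'$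 then $B[\Theta]\xrightarrow{\tau}_\delta\Theta'$ with $\Delta'\mathcal R\Theta'$, and symmetrically. $\sim_s$ is the largest saturated bisimulation. *)

theory Defs
  imports
    "HOL-Probability.Probability_Mass_Function"
    "Jordan_Normal_Form.Schur_Decomposition"
begin

section \<open>Finitely supported distributions\<close>

text \<open>The convex combination of the distributions \<open>D i\<close> with weights \<open>p i\<close>. It is only used for
  finite \<open>I\<close>, nonnegative \<open>p\<close> and \<open>sum p I = 1\<close>; otherwise the value is unspecified.\<close>

definition mix :: "'i set \<Rightarrow> ('i \<Rightarrow> real) \<Rightarrow> ('i \<Rightarrow> 'a pmf) \<Rightarrow> 'a pmf" where
  "mix I p D = embed_pmf (\<lambda>x. \<Sum>i\<in>I. p i * pmf (D i) x)"


section \<open>Operators on qubit registers\<close>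

text \<open>\<open>mat\<close> is not an instance of \<open>comm_monoid_add\<close>, so finite sums of \<open>d \<times> d\<close> matrices are taken
  entrywise.\<close>

definition mat_sum :: "nat \<Rightarrow> ('i \<Rightarrow> complex mat) \<Rightarrow> 'i set \<Rightarrow> complex mat" where
  "mat_sum d A I = mat d d (\<lambda>(x, y). \<Sum>i\<in>I. A i $$ (x, y))"

definition tr :: "complex mat \<Rightarrow> complex" where
  "tr A = (\<Sum>x<dim_row A. A $$ (x, x))"

definition kraus_map :: "nat \<Rightarrow> complex mat list \<Rightarrow> complex mat \<Rightarrow> complex mat" where
  "kraus_map n Ks \<rho> = mat_sum (2 ^ n) (\<lambda>i. Ks ! i * \<rho> * mat_adjoint (Ks ! i)) {..<length Ks}"

definition tp_kraus :: "nat \<Rightarrow> complex mat list \<Rightarrow> bool" where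
  "tp_kraus n Ks \<longleftrightarrow> set Ks \<subseteq> carrier_mat (2 ^ n) (2 ^ n) \<and>
     mat_sum (2 ^ n) (\<lambda>i. mat_adjoint (Ks ! i) * Ks ! i) {..<length Ks} = 1\<^sub>m (2 ^ n)"

definition kraus_rep :: "nat \<Rightarrow> complex mat list \<Rightarrow> (complex mat \<Rightarrow> complex mat) \<Rightarrow> bool" where
  "kraus_rep n Ks f \<longleftrightarrow>
     tp_kraus n Ks \<and> f = restrict (kraus_map n Ks) (carrier_mat (2 ^ n) (2 ^ n))"

lemma mat_adjoint_one: "mat_adjoint (1\<^sub>m d :: complex mat) = 1\<^sub>m d"
  by (rule eq_matI) (auto simp: mat_adjoint_def mat_of_rows_def)

lemma tp_kraus_id: "tp_kraus n [1\<^sub>m (2 ^ n)]"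
proof -
  have "mat_sum (2 ^ n) (\<lambda>i. mat_adjoint ([1\<^sub>m (2 ^ n)] ! i) * [1\<^sub>m (2 ^ n)] ! i) {..<1}
      = (1\<^sub>m (2 ^ n) :: complex mat)"
    unfolding mat_sum_def by (rule eq_matI) (auto simp: mat_adjoint_one)
  then show ?thesis
    by (simp add: tp_kraus_def)
qed

text \<open>A trace-preserving superoperator together with the number of qubits it acts on. Superoperators
  are identified extensionally, so different Kraus families of the same map give the same element.\<close>

typedef superop = "{(n, f). \<exists>Ks. kraus_rep n Ks f}"
  using tp_kraus_id by (fastforce simp: kraus_rep_def)

definition op_arity :: "superop \<Rightarrow> nat" where
  "op_arity E = fst (Rep_superop E)"

definition kraus_of :: "superop \<Rightarrow> complex mat list" where
  "kraus_of E = (SOME Ks. kraus_rep (op_arity E) Ks (snd (Rep_superop E)))"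

text \<open>A measurement: its number of qubits and its operators, indexed by a finite set of outcomes.\<close>

typedef measurement = "{(n, M :: nat \<rightharpoonup> complex mat). finite (dom M) \<and>
    ran M \<subseteq> carrier_mat (2 ^ n) (2 ^ n) \<and>
    mat_sum (2 ^ n) (\<lambda>m. mat_adjoint (the (M m)) * the (M m)) (dom M) = 1\<^sub>m (2 ^ n)}"
proof -
  have "mat_sum (2 ^ 0) (\<lambda>m. mat_adjoint (the ([0 \<mapsto> 1\<^sub>m 1] m)) * the ([0 \<mapsto> 1\<^sub>m 1] m)) {0::nat}
      = (1\<^sub>m (2 ^ 0) :: complex mat)"
    unfolding mat_sum_def by (rule eq_matI) (auto simp: mat_adjoint_one)
  then show ?thesis
    by (intro exI[of _ "(0, [0 \<mapsto> 1\<^sub>m 1])"]) simp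
qed

definition meas_arity :: "measurement \<Rightarrow> nat" where
  "meas_arity M = fst (Rep_measurement M)"

definition outcomes :: "measurement \<Rightarrow> nat set" where
  "outcomes M = dom (snd (Rep_measurement M))"

definition meas_op :: "measurement \<Rightarrow> nat \<Rightarrow> complex mat" where
  "meas_op M m = the (snd (Rep_measurement M) m)"

text \<open>Qubit names are natural numbers. For a finite set \<open>V\<close> of qubits, operators on the space of \<open>V\<close> are
  matrices of dimension \<open>2 ^ card V\<close>. The tensor factors are ordered by increasing qubit name,
  the first factor being the most significant bit of the index of a basis vector.\<close>

type_synonym qubit = nat

definition qbit :: "qubit set \<Rightarrow> nat \<Rightarrow> qubit \<Rightarrow> bool" where
  "qbit V x q = bit x (card {r \<in> V. q < r})"

definition sub_index :: "qubit set \<Rightarrow> qubit list \<Rightarrow> nat \<Rightarrow> nat" where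
  "sub_index V qs x = horner_sum of_bool 2 (map (qbit V x) (rev qs))"

text \<open>The operator acting as \<open>K\<close> on the tuple \<open>qs\<close> (in this order) and as the identity on the other
  qubits of \<open>V\<close>.\<close>

definition ext_op :: "qubit set \<Rightarrow> qubit list \<Rightarrow> complex mat \<Rightarrow> complex mat" where
  "ext_op V qs K = mat (2 ^ card V) (2 ^ card V) (\<lambda>(x, y).
     if \<forall>q\<in>V - set qs. qbit V x q = qbit V y q
     then K $$ (sub_index V qs x, sub_index V qs y) else 0)"

text \<open>The result does not depend on the Kraus family picked by \<open>kraus_of\<close>.\<close>

definition app_op :: "qubit set \<Rightarrow> qubit list \<Rightarrow> superop \<Rightarrow> complex mat \<Rightarrow> complex mat" where
  "app_op V qs E \<rho> = kraus_map (card V) (map (ext_op V qs) (kraus_of E)) \<rho>"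

definition app_meas ::
  "qubit set \<Rightarrow> qubit list \<Rightarrow> measurement \<Rightarrow> nat \<Rightarrow> complex mat \<Rightarrow> complex mat" where
  "app_meas V qs M m \<rho> = ext_op V qs (meas_op M m) * \<rho> * mat_adjoint (ext_op V qs (meas_op M m))"

text \<open>The order on \<open>complex\<close> makes \<open>0 \<le> z\<close> mean that \<open>z\<close> is real and nonnegative.\<close>

definition density_op :: "qubit set \<Rightarrow> complex mat \<Rightarrow> bool" where
  "density_op V \<rho> \<longleftrightarrow> finite V \<and> \<rho> \<in> carrier_mat (2 ^ card V) (2 ^ card V) \<and>
     (\<forall>v\<in>carrier_vec (2 ^ card V). 0 \<le> (\<rho> *\<^sub>v v) \<bullet>c v) \<and> tr \<rho> = 1"


section \<open>Syntax\<close>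

datatype val = VBool bool | VNat nat | VQubit qubit

type_synonym var = nat

datatype exp = Var var | Val val | Not exp | Or exp exp | Leq exp exp | Equal exp exp

abbreviation qb :: "qubit \<Rightarrow> exp" where
  "qb q \<equiv> Val (VQubit q)"

datatype sort = SBool | SNat | SQubit

datatype 'c chan = Chan (csort: sort) 'c

datatype ('c, 't) proc =
    Tau 't "('c, 't) proc"
  | TauPair 't 't "('c, 't) proc"
  | Op 't superop "exp list" "('c, 't) proc"
  | Meas 't measurement "exp list" var "('c, 't) proc"
  | Recv 't "'c chan" var "('c, 't) proc"
  | Zero "exp list"
  | Send 't "'c chan" exp "('c, 't) proc"
  | Cond exp "('c, 't) proc" "('c, 't) proc"
  | Choice "('c, 't) proc" "('c, 't) proc"
  | Par "('c, 't) proc" "('c, 't) proc"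
  | Res "('c, 't) proc" "'c chan"

fun val_sort :: "val \<Rightarrow> sort" where
  "val_sort (VBool b) = SBool"
| "val_sort (VNat n) = SNat"
| "val_sort (VQubit q) = SQubit"

inductive evals :: "exp \<Rightarrow> val \<Rightarrow> bool" where
  "evals (Val v) v"
| "evals e (VBool b) \<Longrightarrow> evals (Not e) (VBool (\<not> b))"
| "evals e (VBool b) \<Longrightarrow> evals f (VBool c) \<Longrightarrow> evals (Or e f) (VBool (b \<or> c))"
| "evals e (VNat m) \<Longrightarrow> evals f (VNat n) \<Longrightarrow> evals (Leq e f) (VBool (m \<le> n))"
| "evals e v \<Longrightarrow> evals f w \<Longrightarrow> evals (Equal e f) (VBool (v = w))"

fun fv_exp :: "exp \<Rightarrow> var set" where
  "fv_exp (Var x) = {x}"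
| "fv_exp (Val v) = {}"
| "fv_exp (Not e) = fv_exp e"
| "fv_exp (Or e f) = fv_exp e \<union> fv_exp f"
| "fv_exp (Leq e f) = fv_exp e \<union> fv_exp f"
| "fv_exp (Equal e f) = fv_exp e \<union> fv_exp f"

fun fv :: "('c, 't) proc \<Rightarrow> var set" where
  "fv (Tau t P) = fv P"
| "fv (TauPair t t' P) = fv P"
| "fv (Op t E es P) = (\<Union>e\<in>set es. fv_exp e) \<union> fv P"
| "fv (Meas t M es x P) = (\<Union>e\<in>set es. fv_exp e) \<union> (fv P - {x})"
| "fv (Recv t c x P) = fv P - {x}"
| "fv (Zero es) = (\<Union>e\<in>set es. fv_exp e)"
| "fv (Send t c e P) = fv_exp e \<union> fv P"
| "fv (Cond e P Q) = fv_exp e \<union> fv P \<union> fv Q"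
| "fv (Choice P Q) = fv P \<union> fv Q"
| "fv (Par P Q) = fv P \<union> fv Q"
| "fv (Res P c) = fv P"

definition closed_proc :: "('c, 't) proc \<Rightarrow> bool" where
  "closed_proc P \<longleftrightarrow> fv P = {}"

fun subst_exp :: "var \<Rightarrow> val \<Rightarrow> exp \<Rightarrow> exp" where
  "subst_exp x v (Var y) = (if y = x then Val v else Var y)"
| "subst_exp x v (Val w) = Val w"
| "subst_exp x v (Not e) = Not (subst_exp x v e)"
| "subst_exp x v (Or e f) = Or (subst_exp x v e) (subst_exp x v f)"
| "subst_exp x v (Leq e f) = Leq (subst_exp x v e) (subst_exp x v f)"
| "subst_exp x v (Equal e f) = Equal (subst_exp x v e) (subst_exp x v f)"

fun subst :: "var \<Rightarrow> val \<Rightarrow> ('c, 't) proc \<Rightarrow> ('c, 't) proc" where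
  "subst x v (Tau t P) = Tau t (subst x v P)"
| "subst x v (TauPair t t' P) = TauPair t t' (subst x v P)"
| "subst x v (Op t E es P) = Op t E (map (subst_exp x v) es) (subst x v P)"
| "subst x v (Meas t M es y P) =
     Meas t M (map (subst_exp x v) es) y (if y = x then P else subst x v P)"
| "subst x v (Recv t c y P) = Recv t c y (if y = x then P else subst x v P)"
| "subst x v (Zero es) = Zero (map (subst_exp x v) es)"
| "subst x v (Send t c e P) = Send t c (subst_exp x v e) (subst x v P)"
| "subst x v (Cond e P Q) = Cond (subst_exp x v e) (subst x v P) (subst x v Q)"
| "subst x v (Choice P Q) = Choice (subst x v P) (subst x v Q)"
| "subst x v (Par P Q) = Par (subst x v P) (subst x v Q)"
| "subst x v (Res P c) = Res (subst x v P) c"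


section \<open>Typing\<close>

text \<open>Typing contexts are sets of qubit names and of variables standing for qubits.\<close>

definition qexps :: "exp set" where
  "qexps = range Var \<union> range qb"

text \<open>The premises \<open>Var x \<notin> S\<close> express the usual convention that bound variables are different
  from the variables of the typing context.\<close>

inductive typed :: "exp set \<Rightarrow> ('c, 't) proc \<Rightarrow> bool" where
  "distinct es \<Longrightarrow> set es \<subseteq> qexps \<Longrightarrow> typed (set es) (Zero es)"
| "typed S P \<Longrightarrow> typed S (Tau t P)"
| "typed S P \<Longrightarrow> typed S (TauPair t t' P)"
| "distinct es \<Longrightarrow> set es \<subseteq> S \<Longrightarrow> length es = op_arity E \<Longrightarrow> typed S P \<Longrightarrow> typed S (Op t E es P)"
| "distinct es \<Longrightarrow> set es \<subseteq> S \<Longrightarrow> length es = meas_arity M \<Longrightarrow> Var x \<notin> S \<Longrightarrow> typed S P \<Longrightarrow>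
     typed S (Meas t M es x P)"
| "csort c \<noteq> SQubit \<Longrightarrow> Var x \<notin> S \<Longrightarrow> typed S P \<Longrightarrow> typed S (Recv t c x P)"
| "csort c = SQubit \<Longrightarrow> Var x \<notin> S \<Longrightarrow> typed (S \<union> {Var x}) P \<Longrightarrow> typed S (Recv t c x P)"
| "csort c \<noteq> SQubit \<Longrightarrow> typed S P \<Longrightarrow> typed S (Send t c e P)"
| "csort c = SQubit \<Longrightarrow> e \<in> qexps \<Longrightarrow> e \<in> S \<Longrightarrow> typed (S - {e}) P \<Longrightarrow> typed S (Send t c e P)"
| "typed S P \<Longrightarrow> typed S Q \<Longrightarrow> typed S (Cond e P Q)"
| "typed S P \<Longrightarrow> typed S Q \<Longrightarrow> typed S (Choice P Q)"
| "typed S P \<Longrightarrow> typed S' Q \<Longrightarrow> S \<inter> S' = {} \<Longrightarrow> typed (S \<union> S') (Par P Q)"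
| "typed S P \<Longrightarrow> typed S (Res P c)"

definition type_of :: "('c, 't) proc \<Rightarrow> exp set" where
  "type_of P = (THE S. typed S P)"


section \<open>Configurations\<close>

text \<open>A configuration \<open>(V, \<rho>, P)\<close> carries the set \<open>V\<close> of qubits on which \<open>\<rho>\<close> is defined.
  In \<open>conf option\<close>, \<open>None\<close> is the deadlock configuration.\<close>

type_synonym ('c, 't) conf = "qubit set \<times> complex mat \<times> ('c, 't) proc"

type_synonym ('c, 't) dist = "('c, 't) conf option pmf"

fun conf_typed :: "qubit set \<Rightarrow> qubit set \<Rightarrow> ('c, 't) conf option \<Rightarrow> bool" where
  "conf_typed V W None = True"
| "conf_typed V W (Some (V', \<rho>, P)) \<longleftrightarrow>
     V' = V \<and> density_op V \<rho> \<and> closed_proc P \<and> typed (qb ` W) P \<and> W \<subseteq> V"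

definition dist_typed :: "qubit set \<Rightarrow> qubit set \<Rightarrow> ('c, 't) dist \<Rightarrow> bool" where
  "dist_typed V W \<Delta> \<longleftrightarrow> finite (set_pmf \<Delta>) \<and> (\<forall>C\<in>set_pmf \<Delta>. conf_typed V W C)"

definition mass :: "('c, 't) dist \<Rightarrow> real" where
  "mass \<Delta> = 1 - pmf \<Delta> None"


section \<open>Semantics\<close>

datatype 't sched = Halt | Single 't | Double 't 't

datatype 'c act = Silent | Output "'c chan" val | Input "'c chan" val

definition par_right :: "('c, 't) proc \<Rightarrow> ('c, 't) conf \<Rightarrow> ('c, 't) conf" where
  "par_right Q = (\<lambda>(V, \<rho>, P). (V, \<rho>, Par P Q))"

definition par_left :: "('c, 't) proc \<Rightarrow> ('c, 't) conf \<Rightarrow> ('c, 't) conf" where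
  "par_left Q = (\<lambda>(V, \<rho>, P). (V, \<rho>, Par Q P))"

definition restrict_conf :: "'c chan \<Rightarrow> ('c, 't) conf \<Rightarrow> ('c, 't) conf" where
  "restrict_conf c = (\<lambda>(V, \<rho>, P). (V, \<rho>, Res P c))"

text \<open>Expressions are not statically sorted. Instead, a channel only transmits values of its own sort,
  and the evaluation of an ill-sorted expression is stuck.\<close>

inductive step :: "('c, 't) conf \<Rightarrow> 'c act \<Rightarrow> 't sched \<Rightarrow> ('c, 't) conf pmf \<Rightarrow> bool" where
  "step (V, \<rho>, Tau t P) Silent (Single t) (return_pmf (V, \<rho>, P))"
| "step (V, \<rho>, TauPair t t' P) Silent (Double t t') (return_pmf (V, \<rho>, P))"
| "evals e v \<Longrightarrow> val_sort v = csort c \<Longrightarrow>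
     step (V, \<rho>, Send t c e P) (Output c v) (Single t) (return_pmf (V, \<rho>, P))"
| "val_sort v = csort c \<Longrightarrow> (\<And>q. v = VQubit q \<Longrightarrow> q \<in> V) \<Longrightarrow>
     step (V, \<rho>, Recv t c x P) (Input c v) (Single t) (return_pmf (V, \<rho>, subst x v P))"
| "step (V, \<rho>, Op t E (map qb qs) P) Silent (Single t) (return_pmf (V, app_op V qs E \<rho>, P))"
| "p = (\<lambda>m. Re (tr (app_meas V qs M m \<rho>))) \<Longrightarrow>
     step (V, \<rho>, Meas t M (map qb qs) y P) Silent (Single t)
       (mix (outcomes M) p (\<lambda>m. return_pmf
          (V, complex_of_real (1 / p m) \<cdot>\<^sub>m app_meas V qs M m \<rho>, subst y (VNat m) P)))"
| "evals e (VBool True) \<Longrightarrow> step (V, \<rho>, P) \<mu> s \<Delta> \<Longrightarrow> step (V, \<rho>, Cond e P Q) \<mu> s \<Delta>"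
| "evals e (VBool False) \<Longrightarrow> step (V, \<rho>, Q) \<mu> s \<Delta> \<Longrightarrow> step (V, \<rho>, Cond e P Q) \<mu> s \<Delta>"
| "step (V, \<rho>, P) \<mu> s \<Delta> \<Longrightarrow> step (V, \<rho>, Choice P Q) \<mu> s \<Delta>"
| "step (V, \<rho>, Q) \<mu> s \<Delta> \<Longrightarrow> step (V, \<rho>, Choice P Q) \<mu> s \<Delta>"
| "step (V, \<rho>, P) \<mu> s \<Delta> \<Longrightarrow> (\<And>v. \<mu> \<noteq> Output c v \<and> \<mu> \<noteq> Input c v) \<Longrightarrow>
     step (V, \<rho>, Res P c) \<mu> s (map_pmf (restrict_conf c) \<Delta>)"
| "step (V, \<rho>, P) \<mu> s \<Delta> \<Longrightarrow> (\<And>c v. \<mu> = Input c v \<Longrightarrow> Val v \<notin> type_of Q) \<Longrightarrow>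
     step (V, \<rho>, Par P Q) \<mu> s (map_pmf (par_right Q) \<Delta>)"
| "step (V, \<rho>, P) \<mu> s \<Delta> \<Longrightarrow> (\<And>c v. \<mu> = Input c v \<Longrightarrow> Val v \<notin> type_of Q) \<Longrightarrow>
     step (V, \<rho>, Par Q P) \<mu> s (map_pmf (par_left Q) \<Delta>)"
| "step (V, \<rho>, P) (Output c v) (Single t) (return_pmf (V, \<rho>, P')) \<Longrightarrow>
   step (V, \<rho>, Q) (Input c v) (Single t') (return_pmf (V, \<rho>, Q')) \<Longrightarrow>
     step (V, \<rho>, Par P Q) Silent (Double t t') (return_pmf (V, \<rho>, Par P' Q'))"
| "step (V, \<rho>, P) (Output c v) (Single t) (return_pmf (V, \<rho>, P')) \<Longrightarrow>
   step (V, \<rho>, Q) (Input c v) (Single t') (return_pmf (V, \<rho>, Q')) \<Longrightarrow>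
     step (V, \<rho>, Par Q P) Silent (Double t t') (return_pmf (V, \<rho>, Par Q' P'))"

inductive step_bot :: "('c, 't) conf option \<Rightarrow> 'c act \<Rightarrow> 't sched \<Rightarrow> ('c, 't) dist \<Rightarrow> bool" where
  "step C \<mu> s \<Delta> \<Longrightarrow> step_bot (Some C) \<mu> s (map_pmf Some \<Delta>)"
| "(\<And>\<Delta>. \<not> step C \<mu> s \<Delta>) \<Longrightarrow> step_bot (Some C) \<mu> s (return_pmf None)"
| "step_bot None \<mu> s (return_pmf None)"

text \<open>Lifting to randomized schedulers, then to distributions of configurations. In both cases the
  decomposition into point distributions is arbitrary and may contain repetitions.\<close>

inductive step_rand ::
  "('c, 't) conf option \<Rightarrow> 'c act \<Rightarrow> 't sched pmf \<Rightarrow> ('c, 't) dist \<Rightarrow> bool" where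
  "finite (J :: nat set) \<Longrightarrow> (\<And>j. j \<in> J \<Longrightarrow> 0 < r j) \<Longrightarrow> sum r J = 1 \<Longrightarrow>
   (\<And>j. j \<in> J \<Longrightarrow> step_bot C \<mu> (s j) (\<Theta> j)) \<Longrightarrow>
     step_rand C \<mu> (mix J r (\<lambda>j. return_pmf (s j))) (mix J r \<Theta>)"

inductive step_dist ::
  "('c, 't) dist \<Rightarrow> 'c act \<Rightarrow> 't sched pmf \<Rightarrow> ('c, 't) dist \<Rightarrow> bool" where
  "finite (I :: nat set) \<Longrightarrow> (\<And>i. i \<in> I \<Longrightarrow> 0 < p i) \<Longrightarrow> sum p I = 1 \<Longrightarrow>
   (\<And>i. i \<in> I \<Longrightarrow> step_rand (C i) \<mu> \<delta> (\<Delta> i)) \<Longrightarrow>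
     step_dist (mix I p (\<lambda>i. return_pmf (C i))) \<mu> \<delta> (mix I p \<Delta>)"

text \<open>Deterministic tagging: the lifted transitions of the distribution, and of all the well-typed
  distributions reachable from it, are deterministic.\<close>

coinductive det_tagged :: "('c, 't) dist \<Rightarrow> bool" where
  "(\<And>\<mu> \<delta> \<Delta>' \<Delta>''. step_dist \<Delta> \<mu> \<delta> \<Delta>' \<Longrightarrow> step_dist \<Delta> \<mu> \<delta> \<Delta>'' \<Longrightarrow> \<Delta>' = \<Delta>'') \<Longrightarrow>
   (\<And>\<mu> \<delta> \<Delta>' V W. step_dist \<Delta> \<mu> \<delta> \<Delta>' \<Longrightarrow> dist_typed V W \<Delta>' \<Longrightarrow> det_tagged \<Delta>') \<Longrightarrow>
     det_tagged \<Delta>"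


section \<open>Contexts and saturated bisimilarity\<close>

text \<open>\<open>ctx_typed V' W Q\<close>: the context with hole of type \<open>W\<close> in parallel with \<open>Q\<close> has type \<open>V'\<close>.\<close>

definition ctx_typed :: "qubit set \<Rightarrow> qubit set \<Rightarrow> ('c, 't) proc \<Rightarrow> bool" where
  "ctx_typed V' W Q \<longleftrightarrow> W \<subseteq> V' \<and> closed_proc Q \<and> typed (qb ` (V' - W)) Q"

definition plug :: "('c, 't) proc \<Rightarrow> ('c, 't) dist \<Rightarrow> ('c, 't) dist" where
  "plug Q = map_pmf (map_option (par_right Q))"

text \<open>Distributions are implicitly restricted to deterministically tagged ones, hence so are the related
  distributions and their instantiations in a context.\<close>

definition sat_bisim :: "(('c, 't) dist \<Rightarrow> ('c, 't) dist \<Rightarrow> bool) \<Rightarrow> bool" where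
  "sat_bisim R \<longleftrightarrow> (\<forall>\<Delta> \<Theta>. R \<Delta> \<Theta> \<longrightarrow>
     det_tagged \<Delta> \<and> det_tagged \<Theta> \<and> mass \<Delta> = mass \<Theta> \<and>
     (\<exists>V W. dist_typed V W \<Delta> \<and> dist_typed V W \<Theta> \<and>
       (\<forall>V' Q \<delta>. ctx_typed V' W Q \<and> V' \<subseteq> V \<and> det_tagged (plug Q \<Delta>) \<and> det_tagged (plug Q \<Theta>) \<longrightarrow>
         (\<forall>\<Delta>'. step_dist (plug Q \<Delta>) Silent \<delta> \<Delta>' \<longrightarrow>
            (\<exists>\<Theta>'. step_dist (plug Q \<Theta>) Silent \<delta> \<Theta>' \<and> R \<Delta>' \<Theta>')) \<and>
         (\<forall>\<Theta>'. step_dist (plug Q \<Theta>) Silent \<delta> \<Theta>' \<longrightarrow>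
            (\<exists>\<Delta>'. step_dist (plug Q \<Delta>) Silent \<delta> \<Delta>' \<and> R \<Delta>' \<Theta>')))))"

definition sat_bisimilar :: "('c, 't) dist \<Rightarrow> ('c, 't) dist \<Rightarrow> bool" where
  "sat_bisimilar \<Delta> \<Theta> \<longleftrightarrow> (\<exists>R. sat_bisim R \<and> R \<Delta> \<Theta>)"

end

(* Relate two distributions when they give the same probability to the deadlock configuration and,
   for every process R, the same unnormalised state: the sum of the operators of the configurations
   running R, weighted by their probabilities. A silent transition of a process under a fixed
   scheduler exists either for all density operators or for none, and its unnormalised result
   depends linearly on the operator (the weight p of a measurement outcome cancels against the
   normalisation 1/p, and for p = 0 the operator vanishes because it is positive with trace 0).
   Choose one such family of transitions for every process and scheduler. By deterministic tagging,
   every transition of a distribution is the one assembled from the chosen families, so transitions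
   of related distributions are matched by related results. *)
theory Submission
  imports Defs
begin

text \<open>One mixed state splits into ensembles in many ways, and the configurations of two such
  ensembles need not correspond. Nothing can therefore be matched configuration by configuration;
  only functions of a configuration that are linear in the state have the same average on both
  sides. Two sources of nonlinearity must be kept out. A measurement renormalises, so the
  transitions themselves are not linear, only the averages of fixed tests over their results. And a
  distribution could a priori resolve the choices of one process differently for different states,
  which would make the result depend on the ensemble. Deterministic tagging excludes this: it
  identifies the given result with one that was assembled without looking at the states. It passes
  on only to well-typed results, which is why preservation of typing, with its bookkeeping of qubits
  sent and received, has to be established. Contexts are easy by comparison: placing a process in
  parallel is injective on processes and leaves the state alone.\<close>

subsection \<open>Positive operators\<close>

lemma mat_adjoint_carrier: "A \<in> carrier_mat n m \<Longrightarrow> mat_adjoint A \<in> carrier_mat m n"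
  by (auto simp: mat_adjoint_def mat_of_rows_def)

lemma mat_adjoint_index:
  fixes A :: "complex mat"
  shows "A \<in> carrier_mat n m \<Longrightarrow> i < m \<Longrightarrow> j < n \<Longrightarrow> mat_adjoint A $$ (i, j) = cnj (A $$ (j, i))"
  by (auto simp: mat_adjoint_def mat_of_rows_def)

lemma index_sandwich:
  fixes A B :: "complex mat"
  assumes "A \<in> carrier_mat d d" "B \<in> carrier_mat d d" "x < d" "y < d"
  shows "(A * B * mat_adjoint A) $$ (x, y) =
    (\<Sum>a<d. \<Sum>b<d. A $$ (x, a) * B $$ (a, b) * cnj (A $$ (y, b)))"
  using assms mat_adjoint_carrier[OF assms(1)]
  by (auto simp: scalar_prod_def mat_adjoint_index lessThan_atLeast0 sum_distrib_left mult.assoc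
      intro!: sum.cong)

lemma sandwich_carrier:
  "A \<in> carrier_mat d d \<Longrightarrow> B \<in> carrier_mat d d \<Longrightarrow> A * B * mat_adjoint A \<in> carrier_mat d d"
  by (intro mult_carrier_mat mat_adjoint_carrier)

text \<open>Vectors are plain functions on indices, and entries from \<open>d\<close> on are never
  read. Sums can then be swapped without dimension side conditions.\<close>

definition quad :: "nat \<Rightarrow> complex mat \<Rightarrow> (nat \<Rightarrow> complex) \<Rightarrow> complex" where
  "quad d A v = (\<Sum>x<d. \<Sum>y<d. A $$ (x, y) * v y * cnj (v x))"

definition psd :: "nat \<Rightarrow> complex mat \<Rightarrow> bool" where
  "psd d A \<longleftrightarrow> A \<in> carrier_mat d d \<and> (\<forall>v. 0 \<le> quad d A v)"

lemma quad_vec: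
  assumes "A \<in> carrier_mat d d" "v \<in> carrier_vec d"
  shows "(A *\<^sub>v v) \<bullet>c v = quad d A (\<lambda>i. v $ i)"
  using assms
  by (auto simp: quad_def scalar_prod_def sum_distrib_right lessThan_atLeast0 intro!: sum.cong)

lemma quad_cong: "(\<And>i. i < d \<Longrightarrow> v i = w i) \<Longrightarrow> quad d A v = quad d A w"
  by (auto simp: quad_def intro!: sum.cong)

lemma density_op_iff:
  "density_op V \<rho> \<longleftrightarrow> finite V \<and> psd (2 ^ card V) \<rho> \<and> tr \<rho> = 1"
proof -
  let ?d = "2 ^ card V"
  have "(\<forall>v\<in>carrier_vec ?d. 0 \<le> (\<rho> *\<^sub>v v) \<bullet>c v) \<longleftrightarrow> (\<forall>v. 0 \<le> quad ?d \<rho> v)"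
    if c: "\<rho> \<in> carrier_mat ?d ?d"
  proof
    assume h: "\<forall>v\<in>carrier_vec ?d. 0 \<le> (\<rho> *\<^sub>v v) \<bullet>c v"
    show "\<forall>v. 0 \<le> quad ?d \<rho> v"
    proof
      fix v
      have "0 \<le> (\<rho> *\<^sub>v vec ?d v) \<bullet>c vec ?d v" using h by auto
      also have "\<dots> = quad ?d \<rho> v"
        by (subst quad_vec[OF c]) (auto intro: quad_cong)
      finally show "0 \<le> quad ?d \<rho> v" .
    qed
  qed (auto simp: quad_vec[OF c])
  then show ?thesis by (auto simp: density_op_def psd_def)
qed

lemma tr_eq: "A \<in> carrier_mat d d \<Longrightarrow> tr A = (\<Sum>x<d. A $$ (x, x))"
  by (auto simp: tr_def)

lemma psd_diag:
  assumes "psd d A" "i < d"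
  shows "0 \<le> A $$ (i, i)"
proof -
  have "quad d A (\<lambda>k. of_bool (k = i)) = (\<Sum>x\<in>{i}. \<Sum>y\<in>{i}. A $$ (x, y))"
    unfolding quad_def using assms(2)
    by (intro sum.mono_neutral_cong_right ballI) (auto intro!: sum.neutral sum.mono_neutral_cong_right)
  then have "quad d A (\<lambda>k. of_bool (k = i)) = A $$ (i, i)" by simp
  then show ?thesis using assms(1) by (metis psd_def)
qed

lemma psd_tr: "psd d A \<Longrightarrow> 0 \<le> tr A"
  by (auto simp: psd_def tr_eq intro!: sum_nonneg psd_diag)

text \<open>The vector is \<open>\<alpha>\<close> times the basis vector at \<open>x\<close> plus
  the one at \<open>y\<close>. With vanishing diagonal entries only the two cross terms
  survive.\<close>

lemma quad_two:
  assumes "x < d" "y < d" "x \<noteq> y" "A $$ (x, x) = 0" "A $$ (y, y) = 0"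
  shows "quad d A (\<lambda>k. if k = x then \<alpha> else if k = y then 1 else 0) =
    A $$ (x, y) * cnj \<alpha> + A $$ (y, x) * \<alpha>"
proof -
  let ?v = "\<lambda>k. if k = x then \<alpha> else if k = y then 1 else (0::complex)"
  have r: "(\<Sum>k<d. f k * ?v k) = f x * \<alpha> + f y" for f
  proof -
    have "(\<Sum>k<d. f k * ?v k) = (\<Sum>k\<in>{x, y}. f k * ?v k)"
      using assms by (intro sum.mono_neutral_right) auto
    then show ?thesis using assms by simp
  qed
  have c: "(\<Sum>k<d. f k * cnj (?v k)) = f x * cnj \<alpha> + f y" for f
  proof -
    have "(\<Sum>k<d. f k * cnj (?v k)) = (\<Sum>k\<in>{x, y}. f k * cnj (?v k))"
      using assms by (intro sum.mono_neutral_right) auto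
    then show ?thesis using assms by simp
  qed
  show ?thesis
  proof -
    have "quad d A ?v = (\<Sum>a<d. (\<Sum>b<d. A $$ (a, b) * ?v b) * cnj (?v a))"
      unfolding quad_def by (simp only: sum_distrib_right)
    also have "\<dots> = (\<Sum>a<d. (A $$ (a, x) * \<alpha> + A $$ (a, y)) * cnj (?v a))"
      by (simp only: r)
    also have "\<dots> = (A $$ (x, x) * \<alpha> + A $$ (x, y)) * cnj \<alpha> + (A $$ (y, x) * \<alpha> + A $$ (y, y))"
      by (rule c)
    finally show ?thesis using assms by simp
  qed
qed

text \<open>Nonnegative diagonal entries with sum 0 all vanish, and a positive form with vanishing
  diagonal has no off-diagonal entries. This handles measurement outcomes of probability 0.\<close>

lemma psd_tr_0:
  assumes p: "psd d A" and t: "tr A = 0" and x: "x < d" and y: "y < d"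
  shows "A $$ (x, y) = 0"
proof -
  have "(\<Sum>i<d. A $$ (i, i)) = 0"
    using p t tr_eq by (metis psd_def)
  then have diag: "A $$ (i, i) = 0" if "i < d" for i
    using sum_nonneg_0[of "{..<d}" "\<lambda>i. A $$ (i, i)"] psd_diag[OF p] that by simp
  show ?thesis
  proof (cases "x = y")
    case False
    have *: "0 \<le> A $$ (x, y) * cnj \<alpha> + A $$ (y, x) * \<alpha>" for \<alpha>
      using p quad_two[OF x y False diag[OF x] diag[OF y]] by (metis psd_def)
    \<comment> \<open>The value is real-linear in \<open>\<alpha>\<close>, so nonnegativity at
      \<open>\<alpha>\<close> and at its negative forces 0.\<close>
    have "A $$ (x, y) * cnj \<alpha> + A $$ (y, x) * \<alpha> = 0" for \<alpha>
      using *[of \<alpha>] *[of "-\<alpha>"] by (auto simp: less_eq_complex_def complex_eq_iff)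
    \<comment> \<open>Up to a factor, the values 1 and \<i> give the sum and the difference of the
      two entries.\<close>
    from this[of 1] this[of \<i>] show ?thesis by (auto simp: complex_eq_iff)
  qed (use diag x in auto)
qed

text \<open>The form of the conjugated operator at \<open>v\<close> is the form of \<open>B\<close>
  at the adjoint of \<open>A\<close> applied to \<open>v\<close>; the sums are only
  reordered.\<close>

lemma psd_sandwich:
  assumes A: "A \<in> carrier_mat d d" and B: "psd d B"
  shows "psd d (A * B * mat_adjoint A)"
proof -
  have c: "B \<in> carrier_mat d d" using B by (simp add: psd_def)
  have "quad d (A * B * mat_adjoint A) v = quad d B (\<lambda>b. \<Sum>y<d. cnj (A $$ (y, b)) * v y)" for v
  proof -
    have "quad d (A * B * mat_adjoint A) v =
        (\<Sum>x<d. \<Sum>y<d. \<Sum>a<d. \<Sum>b<d. A $$ (x, a) * B $$ (a, b) * cnj (A $$ (y, b)) * v y * cnj (v x))"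
      unfolding quad_def
      by (auto simp: index_sandwich[OF A c] sum_distrib_right simp del: index_mult_mat intro!: sum.cong)
    also have "\<dots> = (\<Sum>x<d. \<Sum>a<d. \<Sum>y<d. \<Sum>b<d. A $$ (x, a) * B $$ (a, b) * cnj (A $$ (y, b)) * v y * cnj (v x))"
      by (intro sum.cong refl sum.swap)
    also have "\<dots> = (\<Sum>a<d. \<Sum>x<d. \<Sum>y<d. \<Sum>b<d. A $$ (x, a) * B $$ (a, b) * cnj (A $$ (y, b)) * v y * cnj (v x))"
      by (rule sum.swap)
    also have "\<dots> = (\<Sum>a<d. \<Sum>x<d. \<Sum>b<d. \<Sum>y<d. A $$ (x, a) * B $$ (a, b) * cnj (A $$ (y, b)) * v y * cnj (v x))"
      by (intro sum.cong refl sum.swap)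
    also have "\<dots> = (\<Sum>a<d. \<Sum>b<d. \<Sum>x<d. \<Sum>y<d. A $$ (x, a) * B $$ (a, b) * cnj (A $$ (y, b)) * v y * cnj (v x))"
      by (intro sum.cong refl sum.swap)
    also have "\<dots> = quad d B (\<lambda>b. \<Sum>y<d. cnj (A $$ (y, b)) * v y)"
      unfolding quad_def
    proof (intro sum.cong refl)
      fix a b
      have "B $$ (a, b) * (\<Sum>y<d. cnj (A $$ (y, b)) * v y) * cnj (\<Sum>x<d. cnj (A $$ (x, a)) * v x)
        = (\<Sum>y<d. \<Sum>x<d. A $$ (x, a) * B $$ (a, b) * cnj (A $$ (y, b)) * v y * cnj (v x))"
        by (simp add: sum_distrib_left sum_distrib_right mult_ac)
      also have "\<dots> = (\<Sum>x<d. \<Sum>y<d. A $$ (x, a) * B $$ (a, b) * cnj (A $$ (y, b)) * v y * cnj (v x))"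
        by (rule sum.swap)
      finally show "(\<Sum>x<d. \<Sum>y<d. A $$ (x, a) * B $$ (a, b) * cnj (A $$ (y, b)) * v y * cnj (v x))
        = B $$ (a, b) * (\<Sum>y<d. cnj (A $$ (y, b)) * v y) * cnj (\<Sum>x<d. cnj (A $$ (x, a)) * v x)"
        by simp
    qed
    finally show ?thesis .
  qed
  then show ?thesis
    using B sandwich_carrier[OF A c] by (auto simp: psd_def)
qed

text \<open>Cyclicity of the trace brings the adjoint of \<open>A i\<close> next to
  \<open>A i\<close>. The completeness relation \<open>id\<close> is entrywise, in the form that
  \<open>ext_op_complete\<close> delivers for Kraus families and measurements alike.\<close>

lemma tr_sum_sandwich:
  assumes B: "B \<in> carrier_mat d d" and A: "\<And>i. i \<in> T \<Longrightarrow> A i \<in> carrier_mat d d"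
    and id: "\<And>x y. x < d \<Longrightarrow> y < d \<Longrightarrow>
      (\<Sum>i\<in>T. \<Sum>z<d. cnj (A i $$ (z, x)) * A i $$ (z, y)) = of_bool (x = y)"
  shows "(\<Sum>i\<in>T. tr (A i * B * mat_adjoint (A i))) = tr B"
proof -
  have "(\<Sum>i\<in>T. tr (A i * B * mat_adjoint (A i))) =
      (\<Sum>i\<in>T. \<Sum>z<d. \<Sum>a<d. \<Sum>b<d. A i $$ (z, a) * B $$ (a, b) * cnj (A i $$ (z, b)))"
    by (intro sum.cong refl, subst tr_eq[of _ d], intro sandwich_carrier A B, assumption)
       (auto intro!: sum.cong index_sandwich A B)
  also have "\<dots> = (\<Sum>i\<in>T. \<Sum>a<d. \<Sum>z<d. \<Sum>b<d. A i $$ (z, a) * B $$ (a, b) * cnj (A i $$ (z, b)))"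
    by (intro sum.cong refl sum.swap)
  also have "\<dots> = (\<Sum>a<d. \<Sum>i\<in>T. \<Sum>z<d. \<Sum>b<d. A i $$ (z, a) * B $$ (a, b) * cnj (A i $$ (z, b)))"
    by (rule sum.swap)
  also have "\<dots> = (\<Sum>a<d. \<Sum>i\<in>T. \<Sum>b<d. \<Sum>z<d. A i $$ (z, a) * B $$ (a, b) * cnj (A i $$ (z, b)))"
    by (intro sum.cong refl sum.swap)
  also have "\<dots> = (\<Sum>a<d. \<Sum>b<d. \<Sum>i\<in>T. \<Sum>z<d. A i $$ (z, a) * B $$ (a, b) * cnj (A i $$ (z, b)))"
    by (intro sum.cong refl sum.swap)
  also have "\<dots> = (\<Sum>a<d. \<Sum>b<d. B $$ (a, b) * (\<Sum>i\<in>T. \<Sum>z<d. cnj (A i $$ (z, b)) * A i $$ (z, a)))"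
    by (simp add: sum_distrib_left mult_ac)
  also have "\<dots> = (\<Sum>a<d. \<Sum>b<d. B $$ (a, b) * of_bool (b = a))"
    by (intro sum.cong refl) (simp add: id)
  also have "\<dots> = tr B"
    using B by (simp add: tr_eq of_bool_def if_distrib sum.delta cong: if_cong)
  finally show ?thesis .
qed

lemma mat_sum_carrier: "mat_sum d A I \<in> carrier_mat d d"
  by (simp add: mat_sum_def)

lemma psd_mat_sum:
  assumes "\<And>i. i \<in> I \<Longrightarrow> psd d (A i)"
  shows "psd d (mat_sum d A I)"
proof -
  have "quad d (mat_sum d A I) v = (\<Sum>i\<in>I. quad d (A i) v)" for v
  proof -
    have "quad d (mat_sum d A I) v = (\<Sum>x<d. \<Sum>y<d. \<Sum>i\<in>I. A i $$ (x, y) * v y * cnj (v x))"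
      by (auto simp: quad_def mat_sum_def sum_distrib_right intro!: sum.cong)
    also have "\<dots> = (\<Sum>x<d. \<Sum>i\<in>I. \<Sum>y<d. A i $$ (x, y) * v y * cnj (v x))"
      by (intro sum.cong refl sum.swap)
    also have "\<dots> = (\<Sum>i\<in>I. quad d (A i) v)"
      unfolding quad_def by (rule sum.swap)
    finally show ?thesis .
  qed
  then show ?thesis
    using assms by (auto simp: psd_def mat_sum_carrier intro!: sum_nonneg)
qed

lemma tr_mat_sum:
  assumes "\<And>i. i \<in> I \<Longrightarrow> A i \<in> carrier_mat d d"
  shows "tr (mat_sum d A I) = (\<Sum>i\<in>I. tr (A i))"
proof -
  have "tr (mat_sum d A I) = (\<Sum>x<d. \<Sum>i\<in>I. A i $$ (x, x))"
    by (simp add: tr_def mat_sum_def)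
  also have "\<dots> = (\<Sum>i\<in>I. \<Sum>x<d. A i $$ (x, x))" by (rule sum.swap)
  also have "\<dots> = (\<Sum>i\<in>I. tr (A i))"
    by (intro sum.cong refl) (simp add: tr_eq[OF assms])
  finally show ?thesis .
qed

subsection \<open>Embedding operators into a register\<close>

text \<open>The position of a qubit counts the larger qubits, so it strictly decreases along
  \<open>V\<close>. Injectivity into a set of the same size gives surjectivity.\<close>

lemma qbit_position_bij:
  assumes "finite (V :: qubit set)"
  shows "bij_betw (\<lambda>q. card {r \<in> V. q < r}) V {..<card V}"
proof -
  let ?f = "\<lambda>q. card {r \<in> V. q < r}"
  have lt: "?f q' < ?f q" if "q \<in> V" "q' \<in> V" "q < q'" for q q'
    using that assms by (intro psubset_card_mono) auto
  have inj: "inj_on ?f V"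
  proof (rule inj_onI)
    fix q q' assume "q \<in> V" "q' \<in> V" "?f q = ?f q'"
    then show "q = q'" using lt[of q q'] lt[of q' q] by (metis linorder_neqE_nat less_irrefl)
  qed
  moreover have "?f ` V \<subseteq> {..<card V}"
    using assms by (auto intro!: psubset_card_mono)
  ultimately show ?thesis
    unfolding bij_betw_def by (simp add: card_image card_subset_eq)
qed

lemma qbit_inject:
  assumes "finite V" "x < 2 ^ card V" "y < 2 ^ card V" "\<And>q. q \<in> V \<Longrightarrow> qbit V x q = qbit V y q"
  shows "x = y"
proof (rule bit_eqI)
  fix n
  show "bit x n = bit y n"
  proof (cases "n < card V")
    case True
    then obtain q where "q \<in> V" "n = card {r \<in> V. q < r}"
      using qbit_position_bij[OF assms(1)] by (auto simp: bij_betw_def)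
    then show ?thesis using assms(4)[of q] by (simp add: qbit_def)
  next
    case False
    \<comment> \<open>Bits from \<open>card V\<close> on are false because both indices lie below
      \<open>2 ^ card V\<close>.\<close>
    have "take_bit (card V) x = x" "take_bit (card V) y = y"
      using assms by (simp_all add: take_bit_nat_eq_self_iff)
    then show ?thesis using False by (metis bit_take_bit_iff)
  qed
qed

text \<open>With \<open>qbit_inject\<close>, basis indices below \<open>2 ^ card V\<close> amount to
  boolean assignments to the qubits of \<open>V\<close>.\<close>

lemma qbit_surj:
  assumes "finite V"
  obtains z where "z < 2 ^ card V" "\<And>q. q \<in> V \<Longrightarrow> qbit V z q = f q"
proof
  let ?p = "\<lambda>q. card {r \<in> V. q < r}"
  let ?bs = "map (\<lambda>i. f (inv_into V ?p i)) [0..<card V]"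
  have b: "bij_betw ?p V {..<card V}" by (rule qbit_position_bij[OF assms])
  show "horner_sum of_bool 2 ?bs < (2 :: nat) ^ card V"
    using horner_sum_of_bool_2_less[of ?bs] by simp
  show "qbit V (horner_sum of_bool 2 ?bs) q = f q" if "q \<in> V" for q
    using bij_betwE[OF b] that bij_betw_inv_into_left[OF b that]
    by (simp add: qbit_def bit_horner_sum_bit_iff)
qed

lemma sub_index_less: "sub_index V qs x < 2 ^ length qs"
  using horner_sum_of_bool_2_less[of "map (qbit V x) (rev qs)"] by (simp add: sub_index_def)

lemma bit_sub_index: "bit (sub_index V qs x) i \<longleftrightarrow> i < length qs \<and> qbit V x (rev qs ! i)"
  by (auto simp: sub_index_def bit_horner_sum_bit_iff)

lemma sub_index_eq_iff:
  "sub_index V qs x = sub_index V qs y \<longleftrightarrow> (\<forall>q\<in>set qs. qbit V x q = qbit V y q)"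
proof
  assume "sub_index V qs x = sub_index V qs y"
  then have "qbit V x (rev qs ! i) = qbit V y (rev qs ! i)" if "i < length qs" for i
    using that by (metis bit_sub_index)
  then show "\<forall>q\<in>set qs. qbit V x q = qbit V y q"
    by (metis in_set_conv_nth length_rev set_rev)
next
  assume "\<forall>q\<in>set qs. qbit V x q = qbit V y q"
  then show "sub_index V qs x = sub_index V qs y"
    unfolding sub_index_def by (intro arg_cong[where f = "horner_sum of_bool 2"] map_cong) auto
qed

text \<open>A basis state that agrees with \<open>x\<close> outside \<open>qs\<close> is determined
  by its bits on \<open>qs\<close>, and these are arbitrary. The bijection reindexes a column of
  \<open>ext_op\<close> as a column of the small operator.\<close>

lemma sub_index_bij:
  assumes V: "finite V" and qs: "distinct qs" "set qs \<subseteq> V"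
  shows "bij_betw (sub_index V qs)
    {z. z < 2 ^ card V \<and> (\<forall>q\<in>V - set qs. qbit V z q = qbit V x q)} {..<2 ^ length qs}"
    (is "bij_betw _ ?Z _")
  unfolding bij_betw_def
proof
  show "inj_on (sub_index V qs) ?Z"
  proof (rule inj_onI)
    fix z w assume "z \<in> ?Z" "w \<in> ?Z" "sub_index V qs z = sub_index V qs w"
    then show "z = w"
      by (intro qbit_inject[OF V]) (auto simp: sub_index_eq_iff)
  qed
  show "sub_index V qs ` ?Z = {..<2 ^ length qs}"
  proof (intro equalityI subsetI)
    fix w assume "w \<in> {..<(2::nat) ^ length qs}"
    then have w: "take_bit (length qs) w = w" by (simp add: take_bit_nat_eq_self_iff)
    \<comment> \<open>Inside \<open>qs\<close>, read the bit of \<open>w\<close> at the place that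
      \<open>sub_index\<close> uses; places count from the end of \<open>qs\<close>, hence
      \<open>rev\<close>. The place is unique because \<open>qs\<close> is distinct.\<close>
    define f where "f q = (if q \<in> set qs then bit w (THE i. i < length qs \<and> rev qs ! i = q)
      else qbit V x q)" for q
    obtain z where z: "z < 2 ^ card V" "\<And>q. q \<in> V \<Longrightarrow> qbit V z q = f q"
      using qbit_surj[OF V] by metis
    have "bit w i = bit (sub_index V qs z) i" for i
    proof (cases "i < length qs")
      case True
      then have m: "rev qs ! i \<in> set qs" by (metis length_rev nth_mem set_rev)
      moreover have "(THE j. j < length qs \<and> rev qs ! j = rev qs ! i) = i"
        using qs(1) True by (intro the_equality) (auto simp: nth_eq_iff_index_eq)
      ultimately have "f (rev qs ! i) = bit w i" by (simp add: f_def)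
      moreover have "qbit V z (rev qs ! i) = f (rev qs ! i)" using m qs by (intro z) auto
      ultimately show ?thesis using True by (simp add: bit_sub_index)
    next
      case False
      then show ?thesis using w by (metis bit_take_bit_iff bit_sub_index)
    qed
    then have "w = sub_index V qs z" by (rule bit_eqI)
    moreover have "z \<in> ?Z" using z by (auto simp: f_def)
    ultimately show "w \<in> sub_index V qs ` ?Z" by blast
  qed (auto simp: sub_index_less)
qed

lemma ext_op_carrier: "ext_op V qs K \<in> carrier_mat (2 ^ card V) (2 ^ card V)"
  by (simp add: ext_op_def)

text \<open>Extension by the identity is a tensor product, so a family that is complete on the small
  space stays complete on the register.\<close>

lemma ext_op_complete:
  assumes V: "finite V" and qs: "distinct qs" "set qs \<subseteq> V"
    and K: "\<And>i. i \<in> T \<Longrightarrow> K i \<in> carrier_mat (2 ^ length qs) (2 ^ length qs)"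
    and id: "mat_sum (2 ^ length qs) (\<lambda>i. mat_adjoint (K i) * K i) T = 1\<^sub>m (2 ^ length qs)"
    and x: "x < 2 ^ card V" and y: "y < 2 ^ card V"
  shows "(\<Sum>i\<in>T. \<Sum>z<2 ^ card V. cnj (ext_op V qs (K i) $$ (z, x)) * ext_op V qs (K i) $$ (z, y))
    = of_bool (x = y)"
proof -
  let ?s = "sub_index V qs" and ?n = "2 ^ length qs :: nat" and ?d = "2 ^ card V :: nat"
  let ?eq = "\<lambda>z x. \<forall>q\<in>V - set qs. qbit V z q = qbit V x q"
  have K_id: "(\<Sum>i\<in>T. \<Sum>w<?n. cnj (K i $$ (w, a)) * K i $$ (w, b)) = of_bool (a = b)"
    if "a < ?n" "b < ?n" for a b
  proof -
    have "(\<Sum>i\<in>T. \<Sum>w<?n. cnj (K i $$ (w, a)) * K i $$ (w, b)) =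
        (\<Sum>i\<in>T. (mat_adjoint (K i) * K i) $$ (a, b))"
    proof (rule sum.cong[OF refl])
      fix i assume "i \<in> T"
      note k = K[OF this]
      show "(\<Sum>w<?n. cnj (K i $$ (w, a)) * K i $$ (w, b)) = (mat_adjoint (K i) * K i) $$ (a, b)"
        using k mat_adjoint_carrier[OF k] that
        by (auto simp: scalar_prod_def mat_adjoint_index[OF k] lessThan_atLeast0 intro!: sum.cong)
    qed
    also have "\<dots> = mat_sum ?n (\<lambda>i. mat_adjoint (K i) * K i) T $$ (a, b)"
      using that by (simp add: mat_sum_def)
    also have "\<dots> = of_bool (a = b)" using that by (simp add: id)
    finally show ?thesis .
  qed
  let ?Z = "{z. z < ?d \<and> ?eq z x}"
  \<comment> \<open>Column \<open>x\<close> is supported on the indices in \<open>?Z\<close>. On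
    these, column \<open>y\<close> can be nonzero only if \<open>x\<close> and \<open>y\<close>
    agree outside \<open>qs\<close>.\<close>
  have "(\<Sum>z<?d. cnj (ext_op V qs (K i) $$ (z, x)) * ext_op V qs (K i) $$ (z, y)) =
      of_bool (?eq x y) * (\<Sum>w<?n. cnj (K i $$ (w, ?s x)) * K i $$ (w, ?s y))" for i
  proof -
    have "(\<Sum>z<?d. cnj (ext_op V qs (K i) $$ (z, x)) * ext_op V qs (K i) $$ (z, y)) =
        (\<Sum>z\<in>?Z. of_bool (?eq x y) * (cnj (K i $$ (?s z, ?s x)) * K i $$ (?s z, ?s y)))"
      by (rule sum.mono_neutral_cong_right) (use x y in \<open>auto simp: ext_op_def\<close>)
    also have "\<dots> = of_bool (?eq x y) * (\<Sum>w<?n. cnj (K i $$ (w, ?s x)) * K i $$ (w, ?s y))"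
      unfolding sum_distrib_left
      by (rule sum.reindex_bij_betw[OF sub_index_bij[OF V qs]])
    finally show ?thesis .
  qed
  then have "(\<Sum>i\<in>T. \<Sum>z<?d. cnj (ext_op V qs (K i) $$ (z, x)) * ext_op V qs (K i) $$ (z, y)) =
      of_bool (?eq x y) * of_bool (?s x = ?s y)"
    by (simp add: sum_distrib_left[symmetric] K_id sub_index_less)
  \<comment> \<open>Agreement outside \<open>qs\<close> and equality of the sub-indices together fix
    every bit.\<close>
  also have "\<dots> = of_bool (x = y)"
    using qbit_inject[OF V x y] by (auto simp: sub_index_eq_iff)
  finally show ?thesis .
qed

section \<open>Superoperators and measurements on density operators\<close>

lemma kraus_of: "tp_kraus (op_arity E) (kraus_of E)"
proof -
  obtain n f where nf: "Rep_superop E = (n, f)" by (cases "Rep_superop E")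
  then have "\<exists>Ks. kraus_rep (op_arity E) Ks (snd (Rep_superop E))"
    using Rep_superop[of E] by (simp add: op_arity_def)
  then show ?thesis
    unfolding kraus_of_def by (rule someI2_ex) (simp add: kraus_rep_def)
qed

lemma measurement_complete:
  "finite (outcomes M)"
  "m \<in> outcomes M \<Longrightarrow> meas_op M m \<in> carrier_mat (2 ^ meas_arity M) (2 ^ meas_arity M)"
  "mat_sum (2 ^ meas_arity M) (\<lambda>m. mat_adjoint (meas_op M m) * meas_op M m) (outcomes M)
    = 1\<^sub>m (2 ^ meas_arity M)"
proof -
  obtain n f where nf: "Rep_measurement M = (n, f)" by (cases "Rep_measurement M")
  then have f: "finite (dom f)" "ran f \<subseteq> carrier_mat (2 ^ n) (2 ^ n)"
    "mat_sum (2 ^ n) (\<lambda>m. mat_adjoint (the (f m)) * the (f m)) (dom f) = 1\<^sub>m (2 ^ n)"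
    using Rep_measurement[of M] by auto
  then show "finite (outcomes M)"
    "mat_sum (2 ^ meas_arity M) (\<lambda>m. mat_adjoint (meas_op M m) * meas_op M m) (outcomes M)
      = 1\<^sub>m (2 ^ meas_arity M)"
    by (simp_all add: outcomes_def meas_op_def meas_arity_def nf)
  show "m \<in> outcomes M \<Longrightarrow> meas_op M m \<in> carrier_mat (2 ^ meas_arity M) (2 ^ meas_arity M)"
    using f(2) by (auto simp: outcomes_def meas_op_def meas_arity_def nf ran_def)
qed

lemma density_app_op:
  assumes \<rho>: "density_op V \<rho>" and qs: "distinct qs" "set qs \<subseteq> V" "length qs = op_arity E"
  shows "density_op V (app_op V qs E \<rho>)"
proof -
  let ?d = "2 ^ card V" and ?K = "\<lambda>i. ext_op V qs (kraus_of E ! i)" and ?T = "{..<length (kraus_of E)}"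
  have V: "finite V" and p: "psd ?d \<rho>" and t: "tr \<rho> = 1" using \<rho> by (auto simp: density_op_iff)
  have c: "\<rho> \<in> carrier_mat ?d ?d" using p by (simp add: psd_def)
  have eq: "app_op V qs E \<rho> = mat_sum ?d (\<lambda>i. ?K i * \<rho> * mat_adjoint (?K i)) ?T"
    by (auto simp: app_op_def kraus_map_def mat_sum_def intro!: cong_mat sum.cong)
  have K: "set (kraus_of E) \<subseteq> carrier_mat (2 ^ length qs) (2 ^ length qs)"
      "mat_sum (2 ^ length qs) (\<lambda>i. mat_adjoint (kraus_of E ! i) * kraus_of E ! i) ?T = 1\<^sub>m (2 ^ length qs)"
    using kraus_of[of E] by (simp_all add: tp_kraus_def qs)
  have "tr (app_op V qs E \<rho>) = (\<Sum>i\<in>?T. tr (?K i * \<rho> * mat_adjoint (?K i)))"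
    unfolding eq by (rule tr_mat_sum) (rule sandwich_carrier[OF ext_op_carrier c])
  also have "\<dots> = tr \<rho>"
    by (rule tr_sum_sandwich[OF c ext_op_carrier], rule ext_op_complete[OF V qs(1,2)])
       (use K nth_mem in auto)
  finally show ?thesis
    unfolding density_op_iff eq using V t
    by (auto intro!: psd_mat_sum psd_sandwich ext_op_carrier p)
qed

lemma app_meas_psd:
  "density_op V \<rho> \<Longrightarrow> psd (2 ^ card V) (app_meas V qs M m \<rho>)"
  unfolding app_meas_def density_op_iff by (auto intro: psd_sandwich ext_op_carrier)

text \<open>Positive operators have real trace, so the \<open>Re\<close> in the probabilities of
  \<open>step\<close> loses nothing.\<close>

lemma app_meas_tr:
  assumes "density_op V \<rho>"
  shows "0 \<le> Re (tr (app_meas V qs M m \<rho>))"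
    and "tr (app_meas V qs M m \<rho>) = complex_of_real (Re (tr (app_meas V qs M m \<rho>)))"
  using psd_tr[OF app_meas_psd[OF assms]] by (auto simp: less_eq_complex_def complex_eq_iff)

lemma app_meas_tr_sum:
  assumes \<rho>: "density_op V \<rho>" and qs: "distinct qs" "set qs \<subseteq> V" "length qs = meas_arity M"
  shows "(\<Sum>m\<in>outcomes M. Re (tr (app_meas V qs M m \<rho>))) = 1"
proof -
  have V: "finite V" and c: "\<rho> \<in> carrier_mat (2 ^ card V) (2 ^ card V)" and t: "tr \<rho> = 1"
    using \<rho> by (auto simp: density_op_iff psd_def)
  have "(\<Sum>m\<in>outcomes M. tr (app_meas V qs M m \<rho>)) = tr \<rho>"
    unfolding app_meas_def
    by (rule tr_sum_sandwich[OF c ext_op_carrier], rule ext_op_complete[OF V qs(1,2)])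
       (auto simp: qs measurement_complete)
  then show ?thesis using t by (metis Re_sum one_complex.sel(1))
qed

lemma density_app_meas:
  assumes \<rho>: "density_op V \<rho>" and p: "0 < Re (tr (app_meas V qs M m \<rho>))"
  shows "density_op V (complex_of_real (1 / Re (tr (app_meas V qs M m \<rho>))) \<cdot>\<^sub>m app_meas V qs M m \<rho>)"
proof -
  let ?A = "app_meas V qs M m \<rho>" and ?d = "2 ^ card V"
  let ?c = "complex_of_real (1 / Re (tr ?A))"
  have psd: "psd ?d ?A" by (rule app_meas_psd[OF \<rho>])
  then have c: "?A \<in> carrier_mat ?d ?d" by (simp add: psd_def)
  have "quad ?d (?c \<cdot>\<^sub>m ?A) v = ?c * quad ?d ?A v" for v
    using c by (auto simp: quad_def sum_distrib_left mult_ac intro!: sum.cong)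
  moreover have "0 \<le> ?c" using p by (simp add: less_eq_complex_def)
  ultimately have "psd ?d (?c \<cdot>\<^sub>m ?A)"
    using psd by (simp add: psd_def mult_nonneg_nonneg del: of_real_divide)
  moreover have "tr (?c \<cdot>\<^sub>m ?A) = ?c * tr ?A"
    using c by (simp add: tr_def sum_distrib_left)
  moreover have "?c * tr ?A = 1"
    \<comment> \<open>Only the bare trace is rewritten, so that it cancels against the real part
      inside \<open>?c\<close>.\<close>
    using p by (subst (2) app_meas_tr(2)[OF \<rho>]) (simp flip: of_real_mult)
  ultimately show ?thesis
    using \<rho> unfolding density_op_iff by (simp only:)
qed

subsection \<open>Finitely supported distributions\<close>

lemma pmf_mix:
  assumes "finite I" "\<And>i. i \<in> I \<Longrightarrow> 0 \<le> p i" "sum p I = 1"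
  shows "pmf (mix I p D) x = (\<Sum>i\<in>I. p i * pmf (D i) x)"
  unfolding mix_def
proof (rule pmf_embed_pmf)
  show "0 \<le> (\<Sum>i\<in>I. p i * pmf (D i) x)" for x
    using assms(2) by (intro sum_nonneg mult_nonneg_nonneg) auto
  have "(\<integral>\<^sup>+x. ennreal (\<Sum>i\<in>I. p i * pmf (D i) x) \<partial>count_space UNIV) =
      (\<integral>\<^sup>+x. (\<Sum>i\<in>I. ennreal (p i) * ennreal (pmf (D i) x)) \<partial>count_space UNIV)"
    using assms(2) by (intro nn_integral_cong) (simp add: ennreal_mult sum_ennreal[symmetric])
  also have "\<dots> = (\<Sum>i\<in>I. ennreal (p i))"
    by (simp add: nn_integral_sum nn_integral_cmult nn_integral_pmf)
  also have "\<dots> = 1"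
    using assms by (simp add: sum_ennreal)
  finally show "(\<integral>\<^sup>+x. ennreal (\<Sum>i\<in>I. p i * pmf (D i) x) \<partial>count_space UNIV) = 1" .
qed

text \<open>Indices of weight 0 leave the support, so the operator attached to a measurement outcome
  of probability 0 never has to be a density operator.\<close>

lemma set_pmf_mix:
  assumes "finite I" "\<And>i. i \<in> I \<Longrightarrow> 0 \<le> p i" "sum p I = 1"
  shows "set_pmf (mix I p D) = (\<Union>i\<in>{i \<in> I. 0 < p i}. set_pmf (D i))"
proof -
  have "x \<in> set_pmf (mix I p D) \<longleftrightarrow> (\<exists>i\<in>I. p i * pmf (D i) x \<noteq> 0)" for x
    using assms by (subst set_pmf_iff, subst pmf_mix) (auto simp: sum_nonneg_eq_0_iff)
  then show ?thesis
    using assms(2) by (force simp: set_pmf_iff less_le)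
qed

lemma pmf_bind_finite:
  assumes "finite A" "set_pmf M \<subseteq> A"
  shows "pmf (bind_pmf M G) x = (\<Sum>y\<in>A. pmf M y * pmf (G y) x)"
  unfolding pmf_bind using assms by (subst integral_measure_pmf[OF assms(1)]) auto

text \<open>The rules for lifted transitions ask for families indexed by numbers, with positive
  weights. Enumerating a finite support turns \<open>bind_pmf\<close> into such a family.\<close>

lemma mix_enum:
  assumes f: "bij_betw f I (set_pmf M)" and fin: "finite I"
  shows "mix I (\<lambda>i. pmf M (f i)) (\<lambda>i. G (f i)) = bind_pmf M G"
    and "(\<Sum>i\<in>I. pmf M (f i)) = 1"
proof -
  have M: "finite (set_pmf M)" using f fin bij_betw_finite by blast
  show s: "(\<Sum>i\<in>I. pmf M (f i)) = 1"
    using sum.reindex_bij_betw[OF f, of "pmf M"] sum_pmf_eq_1[OF M] by simp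
  show "mix I (\<lambda>i. pmf M (f i)) (\<lambda>i. G (f i)) = bind_pmf M G"
    by (rule pmf_eqI)
       (simp add: pmf_mix fin s pmf_bind_finite[OF M order.refl]
          sum.reindex_bij_betw[OF f, of "\<lambda>y. pmf M y * pmf (G y) _"])
qed

section \<open>Expected values over finite support\<close>

text \<open>Only meaningful for finite support: otherwise the sum is \<open>0\<close>.\<close>

definition expct :: "'a pmf \<Rightarrow> ('a \<Rightarrow> complex) \<Rightarrow> complex" where
  "expct M h = (\<Sum>x\<in>set_pmf M. complex_of_real (pmf M x) * h x)"

lemma expct_superset:
  assumes "finite A" "set_pmf M \<subseteq> A"
  shows "expct M h = (\<Sum>x\<in>A. complex_of_real (pmf M x) * h x)"
  unfolding expct_def using assms by (intro sum.mono_neutral_left) (auto simp: set_pmf_iff)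

lemma expct_return [simp]: "expct (return_pmf x) h = h x"
  by (simp add: expct_def)

lemma expct_cong: "(\<And>x. x \<in> set_pmf M \<Longrightarrow> h x = h' x) \<Longrightarrow> expct M h = expct M h'"
  unfolding expct_def by (intro sum.cong) auto

lemma expct_zero [simp]: "expct M (\<lambda>x. 0) = 0"
  by (simp add: expct_def)

lemma expct_bind:
  assumes M: "finite (set_pmf M)" and G: "\<And>x. x \<in> set_pmf M \<Longrightarrow> finite (set_pmf (G x))"
  shows "expct (bind_pmf M G) h = expct M (\<lambda>x. expct (G x) h)"
proof -
  let ?A = "\<Union>x\<in>set_pmf M. set_pmf (G x)"
  have A: "finite ?A" using M G by blast
  have "expct (bind_pmf M G) h = (\<Sum>y\<in>?A. complex_of_real (\<Sum>x\<in>set_pmf M. pmf M x * pmf (G x) y) * h y)"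
    by (subst expct_superset[OF A]) (auto simp: pmf_bind_finite[OF M])
  also have "\<dots> = (\<Sum>y\<in>?A. \<Sum>x\<in>set_pmf M. complex_of_real (pmf M x) * (complex_of_real (pmf (G x) y) * h y))"
    by (simp add: sum_distrib_right mult.assoc)
  also have "\<dots> = (\<Sum>x\<in>set_pmf M. \<Sum>y\<in>?A. complex_of_real (pmf M x) * (complex_of_real (pmf (G x) y) * h y))"
    by (rule sum.swap)
  also have "\<dots> = (\<Sum>x\<in>set_pmf M. complex_of_real (pmf M x) * expct (G x) h)"
    by (intro sum.cong refl, subst expct_superset[OF A]) (auto simp: sum_distrib_left)
  finally show ?thesis by (simp add: expct_def)
qed

lemma expct_map:
  assumes "finite (set_pmf M)"
  shows "expct (map_pmf f M) h = expct M (\<lambda>x. h (f x))"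
  unfolding map_pmf_def by (subst expct_bind[OF assms]) auto

lemma expct_mix:
  assumes I: "finite I" "\<And>i. i \<in> I \<Longrightarrow> 0 \<le> p i" "sum p I = 1"
    and D: "\<And>i. i \<in> I \<Longrightarrow> finite (set_pmf (D i))"
  shows "expct (mix I p D) h = (\<Sum>i\<in>I. complex_of_real (p i) * expct (D i) h)"
proof -
  let ?A = "\<Union>i\<in>I. set_pmf (D i)"
  have A: "finite ?A" using I D by blast
  have "expct (mix I p D) h = (\<Sum>x\<in>?A. complex_of_real (\<Sum>i\<in>I. p i * pmf (D i) x) * h x)"
    by (subst expct_superset[OF A]) (auto simp: set_pmf_mix[OF I] pmf_mix[OF I])
  also have "\<dots> = (\<Sum>x\<in>?A. \<Sum>i\<in>I. complex_of_real (p i) * (complex_of_real (pmf (D i) x) * h x))"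
    by (simp add: sum_distrib_right mult.assoc)
  also have "\<dots> = (\<Sum>i\<in>I. \<Sum>x\<in>?A. complex_of_real (p i) * (complex_of_real (pmf (D i) x) * h x))"
    by (rule sum.swap)
  also have "\<dots> = (\<Sum>i\<in>I. complex_of_real (p i) * expct (D i) h)"
    by (intro sum.cong refl, subst expct_superset[OF A]) (auto simp: sum_distrib_left)
  finally show ?thesis .
qed

lemma expct_add: "expct M (\<lambda>x. f x + g x) = expct M f + expct M g"
  by (simp add: expct_def distrib_left sum.distrib)

lemma expct_scale: "expct M (\<lambda>x. k * f x) = k * expct M f"
  by (simp add: expct_def sum_distrib_left mult_ac)

lemma expct_sum: "expct M (\<lambda>x. \<Sum>i\<in>I. f i x) = (\<Sum>i\<in>I. expct M (f i))"
  unfolding expct_def sum_distrib_left by (rule sum.swap)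

text \<open>Lets the average over schedulers be taken last, so that linearity in the state can be
  used for each scheduler separately.\<close>

lemma expct_swap: "expct M (\<lambda>x. expct N (h x)) = expct N (\<lambda>y. expct M (\<lambda>x. h x y))"
proof -
  have "expct M (\<lambda>x. expct N (h x)) = (\<Sum>y\<in>set_pmf N. expct M (\<lambda>x. complex_of_real (pmf N y) * h x y))"
    unfolding expct_def[of N] by (rule expct_sum)
  then show ?thesis by (simp add: expct_scale expct_def[of N])
qed

subsection \<open>Typing\<close>

lemma typed_qexps: "typed S P \<Longrightarrow> S \<subseteq> qexps"
  by (induction rule: typed.induct) auto

inductive_cases typed_TauE: "typed S (Tau t P)"
inductive_cases typed_TauPairE: "typed S (TauPair t t' P)"
inductive_cases typed_OpE: "typed S (Op t E es P)"
inductive_cases typed_MeasE: "typed S (Meas t M es x P)"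
inductive_cases typed_RecvE: "typed S (Recv t c x P)"
inductive_cases typed_SendE: "typed S (Send t c e P)"
inductive_cases typed_CondE: "typed S (Cond e P Q)"
inductive_cases typed_ChoiceE: "typed S (Choice P Q)"
inductive_cases typed_ParE: "typed S (Par P Q)"
inductive_cases typed_ResE: "typed S (Res P c)"

lemma subst_exp_qexps: "e \<in> qexps \<Longrightarrow> e \<noteq> Var x \<Longrightarrow> subst_exp x v e = e"
  by (cases e) (auto simp: qexps_def)

lemma subst_qexps: "e \<in> qexps \<Longrightarrow> subst_exp x (VQubit q) e \<in> qexps"
  by (auto simp: qexps_def)

lemma map_subst_exp_id:
  "set es \<subseteq> S \<Longrightarrow> S \<subseteq> qexps \<Longrightarrow> Var x \<notin> S \<Longrightarrow> map (subst_exp x v) es = es"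
  by (rule map_idI) (auto intro!: subst_exp_qexps)

text \<open>Typing only constrains expressions that stand for owned qubits. These are qubit names or
  variables from the context, hence different from \<open>Var x\<close> and left alone. Covers
  classical inputs and measurement outcomes.\<close>

lemma typed_subst_fresh: "typed S P \<Longrightarrow> Var x \<notin> S \<Longrightarrow> typed S (subst x v P)"
proof (induction rule: typed.induct)
  case (1 es)
  then have "map (subst_exp x v) es = es" by (intro map_subst_exp_id[OF order.refl])
  then show ?case using 1 by (auto intro: typed.intros)
next
  case (4 es S E P t)
  then have "map (subst_exp x v) es = es" by (meson map_subst_exp_id typed_qexps)
  then show ?case using 4 by (auto intro: typed.intros)
next
  case (5 es S M y P t)
  then have "map (subst_exp x v) es = es" by (meson map_subst_exp_id typed_qexps)
  then show ?case using 5 by (auto intro: typed.intros)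
next
  case (9 c e S P t)
  then have "subst_exp x v e = e" by (intro subst_exp_qexps) auto
  then show ?case using 9 by (auto intro: typed.intros)
qed (auto intro: typed.intros)

lemma subst_exp_image:
  assumes "S \<subseteq> qexps"
  shows "subst_exp x (VQubit q) ` S = (if Var x \<in> S then S - {Var x} \<union> {qb q} else S)"
proof -
  have "subst_exp x (VQubit q) e = (if e = Var x then qb q else e)" if "e \<in> S" for e
    using assms that by (auto simp: subst_exp_qexps)
  then show ?thesis by (auto simp: image_iff split: if_splits)
qed

text \<open>If \<open>q\<close> were already in the context, the variable and the qubit would be
  identified, which is the duplication that linear typing forbids.\<close>

lemma inj_on_subst_exp:
  assumes "S \<subseteq> qexps" "qb q \<notin> S"
  shows "inj_on (subst_exp x (VQubit q)) S"
proof (rule inj_onI)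
  fix e f assume ef: "e \<in> S" "f \<in> S" "subst_exp x (VQubit q) e = subst_exp x (VQubit q) f"
  have "subst_exp x (VQubit q) e = (if e = Var x then qb q else e)" if "e \<in> S" for e
    using assms that by (auto simp: subst_exp_qexps)
  then show "e = f" using ef assms(2) by (metis (full_types))
qed

text \<open>Injectivity on the context carries over distinct argument tuples, the removal of a sent
  qubit and the disjointness of parallel contexts. \<open>S\<close> may or may not contain
  \<open>Var x\<close>, since at a parallel composition at most one side owns it.\<close>

lemma typed_subst_qubit:
  "typed S P \<Longrightarrow> qb q \<notin> S \<Longrightarrow> typed (subst_exp x (VQubit q) ` S) (subst x (VQubit q) P)"
proof (induction rule: typed.induct)
  case (1 es)
  then show ?case
    using inj_on_subst_exp[of "set es" q x] typed.intros(1)[of "map (subst_exp x (VQubit q)) es"]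
      subst_qexps[of _ x q]
    by (simp add: distinct_map image_subset_iff subset_iff image_iff) blast
next
  case (4 es S E P t)
  then have "inj_on (subst_exp x (VQubit q)) S" by (intro inj_on_subst_exp typed_qexps)
  then have "distinct (map (subst_exp x (VQubit q)) es)"
    using 4 by (auto simp: distinct_map intro: inj_on_subset)
  then show ?case using 4 by (simp add: typed.intros image_mono)
next
  case (5 es S M y P t)
  have "S \<subseteq> qexps" using 5 typed_qexps by blast
  then have i: "inj_on (subst_exp x (VQubit q)) S" and im: "Var y \<notin> subst_exp x (VQubit q) ` S"
    using 5 by (auto intro: inj_on_subst_exp simp: subst_exp_image)
  have "distinct (map (subst_exp x (VQubit q)) es)"
    using 5 i by (auto simp: distinct_map intro: inj_on_subset)
  moreover have "y = x \<Longrightarrow> subst_exp x (VQubit q) ` S = S"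
    using 5 \<open>S \<subseteq> qexps\<close> by (simp add: subst_exp_image)
  moreover have "set (map (subst_exp x (VQubit q)) es) \<subseteq> subst_exp x (VQubit q) ` S"
    using 5(2) by (simp add: image_mono)
  ultimately show ?case using 5 im by (cases "y = x") (auto simp del: set_map intro!: typed.intros)
next
  case (6 c y S P t)
  have "S \<subseteq> qexps" using 6 typed_qexps by blast
  then have im: "Var y \<notin> subst_exp x (VQubit q) ` S" "y = x \<Longrightarrow> subst_exp x (VQubit q) ` S = S"
    using 6 by (auto simp: subst_exp_image)
  then show ?case using 6 by (cases "y = x") (auto intro!: typed.intros(6))
next
  case (7 c y S P t)
  have "S \<subseteq> qexps" using 7 typed_qexps by blast
  then have im: "Var y \<notin> subst_exp x (VQubit q) ` S" "y = x \<Longrightarrow> subst_exp x (VQubit q) ` S = S"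
    using 7 by (auto simp: subst_exp_image)
  show ?case
  proof (cases "y = x")
    case True
    then show ?thesis using 7 im by (auto intro!: typed.intros(7))
  next
    case False
    then have "typed (insert (Var y) (subst_exp x (VQubit q) ` S)) (subst x (VQubit q) P)"
      using 7 by simp
    then show ?thesis using 7 im False by (auto intro!: typed.intros(7))
  qed
next
  case (9 c e S P t)
  have S: "S \<subseteq> qexps" using 9(2,4) typed_qexps by blast
  have "subst_exp x (VQubit q) ` (S - {e}) = subst_exp x (VQubit q) ` S - {subst_exp x (VQubit q) e}"
    using inj_on_image_set_diff[OF inj_on_subst_exp[OF S 9(6)], of S "{e}"] 9(3) by simp
  moreover have "subst_exp x (VQubit q) e \<in> qexps" using 9(2) by (auto simp: qexps_def)
  ultimately show ?case using 9 by (auto intro!: typed.intros(9))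
next
  case (12 S P S' Q)
  have "S \<union> S' \<subseteq> qexps" using 12 typed_qexps by blast
  from inj_on_subst_exp[OF this 12(6)] have "subst_exp x (VQubit q) ` S \<inter> subst_exp x (VQubit q) ` S' = {}"
    using 12(3) by (metis image_empty inj_on_image_Int sup_ge1 sup_ge2)
  then show ?case using 12 by (auto simp: image_Un intro!: typed.intros)
qed (auto intro: typed.intros)

section \<open>Subject reduction\<close>

lemma fv_exp_subst: "fv_exp (subst_exp x v e) = fv_exp e - {x}"
  by (induction e) auto

lemma fv_subst: "fv (subst x v P) = fv P - {x}"
  by (induction P) (auto simp: fv_exp_subst)

lemma evals_qexps: "evals e v \<Longrightarrow> e \<in> qexps \<Longrightarrow> \<exists>q. v = VQubit q \<and> e = qb q"
  by (auto simp: qexps_def elim: evals.cases)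

fun act_type :: "'c act \<Rightarrow> exp set \<Rightarrow> exp set" where
  "act_type Silent S = S"
| "act_type (Output c v) S = (if csort c = SQubit then S - {Val v} else S)"
| "act_type (Input c v) S = (if csort c = SQubit then S \<union> {Val v} else S)"

lemma map_qb:
  assumes "distinct (map qb qs)" "set (map qb qs) \<subseteq> S" "S \<subseteq> qb ` V"
  shows "distinct qs" "set qs \<subseteq> V"
  using assms by (auto simp: distinct_map)

text \<open>The induction has to cover visible actions, because a communication has an output and an
  input as premises. The first conjunct says that a sender owns the qubit it sends; with disjoint
  contexts this supplies the freshness assumption for the receiver.\<close>

lemma step_type:
  assumes "step (V, \<rho>, P) \<mu> s \<Delta>" "typed S P" "S \<subseteq> qb ` V" "density_op V \<rho>" "fv P = {}"
    and "\<And>c v. \<mu> = Input c v \<Longrightarrow> csort c = SQubit \<Longrightarrow> Val v \<notin> S"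
  shows "(\<forall>c v. \<mu> = Output c v \<longrightarrow> csort c = SQubit \<longrightarrow> Val v \<in> S) \<and> finite (set_pmf \<Delta>) \<and>
    (\<forall>(V', \<rho>', P')\<in>set_pmf \<Delta>. V' = V \<and> density_op V \<rho>' \<and> fv P' = {} \<and> typed (act_type \<mu> S) P')"
  using assms
proof (induction "(V, \<rho>, P)" \<mu> s \<Delta> arbitrary: P S rule: step.induct)
  case (3 e v c t P)
  show ?case
  proof (cases "csort c = SQubit")
    case True
    then have "e \<in> qexps" "e \<in> S" "typed (S - {e}) P"
      using 3(3) by (auto elim: typed_SendE)
    moreover have "e = Val v" using evals_qexps[OF 3(1)] \<open>e \<in> qexps\<close> by blast
    ultimately show ?thesis using 3 True by auto
  next
    case False
    then show ?thesis using 3 by (auto elim: typed_SendE)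
  qed
next
  case (4 v c t x P)
  show ?case
  proof (cases "csort c = SQubit")
    case True
    then obtain q where q: "v = VQubit q" using 4(1) by (cases v) auto
    have t: "Var x \<notin> S" "typed (S \<union> {Var x}) P" using 4(3) True by (auto elim: typed_RecvE)
    have "qb q \<notin> S \<union> {Var x}" using 4(7) True q by auto
    from typed_subst_qubit[OF t(2) this, of x]
    have "typed (insert (qb q) S) (subst x v P)"
      using t typed_qexps[OF t(2)] q by (simp add: subst_exp_image)
    then show ?thesis using 4 True q by (auto simp: fv_subst)
  next
    case False
    then have "typed S (subst x v P)" using 4(3) by (auto elim: typed_RecvE intro: typed_subst_fresh)
    then show ?thesis using 4 False by (auto simp: fv_subst)
  qed
next
  case (5 t E qs P)
  then have t: "distinct (map qb qs)" "set (map qb qs) \<subseteq> S" "length qs = op_arity E" "typed S P"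
    by (auto elim!: typed_OpE simp del: set_map)
  then show ?case using 5 density_app_op[OF _ map_qb[OF t(1,2)]] by auto
next
  case (6 p qs M t y P)
  then have t: "distinct (map qb qs)" "set (map qb qs) \<subseteq> S" "length qs = meas_arity M" "typed S P"
      "Var y \<notin> S"
    by (auto elim!: typed_MeasE simp del: set_map)
  note q = map_qb[OF t(1,2) 6(3)]
  have p: "p m \<ge> 0" "sum p (outcomes M) = 1" for m
    unfolding 6(1) using app_meas_tr(1) app_meas_tr_sum[OF _ q t(3)] 6(4) by auto
  \<comment> \<open>Only outcomes of positive probability occur in the support, so normalisation is
    needed for these alone.\<close>
  have d: "density_op V (complex_of_real (1 / p m) \<cdot>\<^sub>m app_meas V qs M m \<rho>)" if "0 < p m" for m
    using that density_app_meas[OF 6(4)] by (simp add: 6(1))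
  show ?case
    unfolding set_pmf_mix[OF measurement_complete(1) p]
    using d typed_subst_fresh[OF t(4,5)] 6(5) by (auto simp: fv_subst measurement_complete(1))
next
  case (12 P \<mu> s \<Delta> Q)
  obtain S1 S2 where S: "S = S1 \<union> S2" "typed S1 P" "typed S2 Q" "S1 \<inter> S2 = {}"
    using 12(4) by (auto elim: typed_ParE)
  have IH: "(\<forall>c v. \<mu> = Output c v \<longrightarrow> csort c = SQubit \<longrightarrow> Val v \<in> S1) \<and> finite (set_pmf \<Delta>) \<and>
      (\<forall>(V', \<rho>', P')\<in>set_pmf \<Delta>. V' = V \<and> density_op V \<rho>' \<and> fv P' = {} \<and> typed (act_type \<mu> S1) P')"
    by (rule 12(2)[OF S(2) _ 12(6)]) (use 12(5,7,8) S(1) in auto)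
  \<comment> \<open>A qubit that enters is new to all of \<open>S\<close>, and one that leaves
    belongs to \<open>S1\<close>, so \<open>S2\<close> is untouched and stays disjoint.\<close>
  have t: "act_type \<mu> S = act_type \<mu> S1 \<union> S2" "act_type \<mu> S1 \<inter> S2 = {}"
    using conjunct1[OF IH] S(1,4) 12(8) by (cases \<mu>; auto)+
  have "V' = V \<and> density_op V \<rho>' \<and> fv R = {} \<and> typed (act_type \<mu> S) R"
    if R: "(V', \<rho>', R) \<in> set_pmf (map_pmf (par_right Q) \<Delta>)" for V' \<rho>' R
  proof -
    obtain P' where "R = Par P' Q" "(V', \<rho>', P') \<in> set_pmf \<Delta>"
      using R by (auto simp: par_right_def split: prod.splits)
    then show ?thesis using IH typed.intros(12)[OF _ S(3) t(2)] t(1) 12(7) by auto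
  qed
  moreover have "\<forall>c v. \<mu> = Output c v \<longrightarrow> csort c = SQubit \<longrightarrow> Val v \<in> S" using IH S(1) by blast
  moreover have "finite (set_pmf (map_pmf (par_right Q) \<Delta>))" using IH by simp
  ultimately show ?case by fast
next
  case (13 P \<mu> s \<Delta> Q)
  obtain S1 S2 where S: "S = S2 \<union> S1" "typed S1 P" "typed S2 Q" "S2 \<inter> S1 = {}"
    using 13(4) by (auto elim: typed_ParE)
  have IH: "(\<forall>c v. \<mu> = Output c v \<longrightarrow> csort c = SQubit \<longrightarrow> Val v \<in> S1) \<and> finite (set_pmf \<Delta>) \<and>
      (\<forall>(V', \<rho>', P')\<in>set_pmf \<Delta>. V' = V \<and> density_op V \<rho>' \<and> fv P' = {} \<and> typed (act_type \<mu> S1) P')"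
    by (rule 13(2)[OF S(2) _ 13(6)]) (use 13(5,7,8) S(1) in auto)
  have t: "act_type \<mu> S = S2 \<union> act_type \<mu> S1" "S2 \<inter> act_type \<mu> S1 = {}"
    using conjunct1[OF IH] S(1,4) 13(8) by (cases \<mu>; auto)+
  have "V' = V \<and> density_op V \<rho>' \<and> fv R = {} \<and> typed (act_type \<mu> S) R"
    if R: "(V', \<rho>', R) \<in> set_pmf (map_pmf (par_left Q) \<Delta>)" for V' \<rho>' R
  proof -
    obtain P' where "R = Par Q P'" "(V', \<rho>', P') \<in> set_pmf \<Delta>"
      using R by (auto simp: par_left_def split: prod.splits)
    then show ?thesis using IH typed.intros(12)[OF S(3) _ t(2)] t(1) 13(7) by auto
  qed
  moreover have "\<forall>c v. \<mu> = Output c v \<longrightarrow> csort c = SQubit \<longrightarrow> Val v \<in> S" using IH S(1) by blast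
  moreover have "finite (set_pmf (map_pmf (par_left Q) \<Delta>))" using IH by simp
  ultimately show ?case by fast
next
  case (14 P c v t P' Q t' Q')
  obtain S1 S2 where S: "S = S1 \<union> S2" "typed S1 P" "typed S2 Q" "S1 \<inter> S2 = {}"
    using 14(5) by (auto elim: typed_ParE)
  have fv: "fv P = {}" "fv Q = {}" using 14(8) by auto
  have SV: "S1 \<subseteq> qb ` V" "S2 \<subseteq> qb ` V" using S(1) 14(6) by auto
  from 14(2)[OF S(2) SV(1) 14(7) fv(1)]
  have P': "csort c = SQubit \<Longrightarrow> Val v \<in> S1" "fv P' = {}" "typed (act_type (Output c v) S1) P'"
    by auto
  \<comment> \<open>The sender owned the qubit, so the receiver did not: this is the freshness
    assumption of the second induction hypothesis.\<close>
  from P'(1) S(4) have "csort c = SQubit \<Longrightarrow> Val v \<notin> S2" by auto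
  with 14(4)[OF S(3) SV(2) 14(7) fv(2)]
  have Q': "fv Q' = {}" "typed (act_type (Input c v) S2) Q'"
    by auto
  have t: "act_type (Output c v) S1 \<union> act_type (Input c v) S2 = S" "act_type (Output c v) S1 \<inter> act_type (Input c v) S2 = {}"
    using P'(1) S(1,4) by auto
  have "typed S (Par P' Q')"
    using typed.intros(12)[OF P'(3) Q'(2) t(2)] by (simp only: t(1))
  then show ?case using P'(2) Q'(1) 14(7) by auto
next
  case (15 P c v t P' Q t' Q')
  obtain S1 S2 where S: "S = S2 \<union> S1" "typed S1 P" "typed S2 Q" "S2 \<inter> S1 = {}"
    using 15(5) by (auto elim: typed_ParE)
  have fv: "fv P = {}" "fv Q = {}" using 15(8) by auto
  have SV: "S1 \<subseteq> qb ` V" "S2 \<subseteq> qb ` V" using S(1) 15(6) by auto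
  from 15(2)[OF S(2) SV(1) 15(7) fv(1)]
  have P': "csort c = SQubit \<Longrightarrow> Val v \<in> S1" "fv P' = {}" "typed (act_type (Output c v) S1) P'"
    by auto
  from P'(1) S(4) have "csort c = SQubit \<Longrightarrow> Val v \<notin> S2" by auto
  with 15(4)[OF S(3) SV(2) 15(7) fv(2)]
  have Q': "fv Q' = {}" "typed (act_type (Input c v) S2) Q'"
    by auto
  have t: "act_type (Input c v) S2 \<union> act_type (Output c v) S1 = S" "act_type (Input c v) S2 \<inter> act_type (Output c v) S1 = {}"
    using P'(1) S(1,4) by auto
  have "typed S (Par Q' P')"
    using typed.intros(12)[OF Q'(2) P'(3) t(2)] by (simp only: t(1))
  then show ?case using P'(2) Q'(1) 15(7) by auto
next
  case (7 e P \<mu> s \<Delta> Q)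
  show ?case by (rule 7(3)) (use 7(4-8) in \<open>auto elim: typed_CondE\<close>)
next
  case (8 e Q \<mu> s \<Delta> P)
  show ?case by (rule 8(3)) (use 8(4-8) in \<open>auto elim: typed_CondE\<close>)
next
  case (9 P \<mu> s \<Delta> Q)
  show ?case by (rule 9(2)) (use 9(3-7) in \<open>auto elim: typed_ChoiceE\<close>)
next
  case (10 Q \<mu> s \<Delta> P)
  show ?case by (rule 10(2)) (use 10(3-7) in \<open>auto elim: typed_ChoiceE\<close>)
next
  case (11 P \<mu> s \<Delta> c)
  have IH: "(\<forall>c v. \<mu> = Output c v \<longrightarrow> csort c = SQubit \<longrightarrow> Val v \<in> S) \<and> finite (set_pmf \<Delta>) \<and>
      (\<forall>(V', \<rho>', P')\<in>set_pmf \<Delta>. V' = V \<and> density_op V \<rho>' \<and> fv P' = {} \<and> typed (act_type \<mu> S) P')"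
    by (rule 11(2)) (use 11(4-8) in \<open>auto elim: typed_ResE\<close>)
  have "V' = V \<and> density_op V \<rho>' \<and> fv R = {} \<and> typed (act_type \<mu> S) R"
    if R: "(V', \<rho>', R) \<in> set_pmf (map_pmf (restrict_conf c) \<Delta>)" for V' \<rho>' R
  proof -
    obtain P' where "R = Res P' c" "(V', \<rho>', P') \<in> set_pmf \<Delta>"
      using R by (auto simp: restrict_conf_def split: prod.splits)
    then show ?thesis using IH by (auto intro: typed.intros)
  qed
  moreover have "finite (set_pmf (map_pmf (restrict_conf c) \<Delta>))" using IH by simp
  ultimately show ?case using conjunct1[OF IH] by fast
qed (auto elim!: typed_TauE typed_TauPairE)

subsection \<open>Transitions depend linearly on the state\<close>

text \<open>Visible actions stem from send and receive prefixes, which neither inspect nor change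
  the operator. The same target process therefore serves for every operator on the register.\<close>

lemma step_visible:
  assumes "step (V, \<rho>, P) \<mu> s \<Delta>" "\<mu> \<noteq> Silent"
  shows "\<exists>P'. \<Delta> = return_pmf (V, \<rho>, P') \<and> (\<forall>\<rho>'. step (V, \<rho>', P) \<mu> s (return_pmf (V, \<rho>', P')))"
  using assms
proof (induction "(V, \<rho>, P)" \<mu> s \<Delta> arbitrary: P rule: step.induct)
  case (11 P \<mu> s \<Delta> c)
  then obtain P' where P': "\<Delta> = return_pmf (V, \<rho>, P')" "\<And>\<rho>'. step (V, \<rho>', P) \<mu> s (return_pmf (V, \<rho>', P'))"
    by auto
  have "step (V, \<rho>', Res P c) \<mu> s (return_pmf (V, \<rho>', Res P' c))" for \<rho>'
    using step.intros(11)[OF P'(2) 11(3)] by (simp add: restrict_conf_def)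
  then show ?case using P' by (auto simp: restrict_conf_def)
next
  case (12 P \<mu> s \<Delta> Q)
  then obtain P' where P': "\<Delta> = return_pmf (V, \<rho>, P')" "\<And>\<rho>'. step (V, \<rho>', P) \<mu> s (return_pmf (V, \<rho>', P'))"
    by auto
  have "step (V, \<rho>', Par P Q) \<mu> s (return_pmf (V, \<rho>', Par P' Q))" for \<rho>'
    using step.intros(12)[OF P'(2) 12(3)] by (simp add: par_right_def)
  then show ?case using P' by (auto simp: par_right_def)
next
  case (13 P \<mu> s \<Delta> Q)
  then obtain P' where P': "\<Delta> = return_pmf (V, \<rho>, P')" "\<And>\<rho>'. step (V, \<rho>', P) \<mu> s (return_pmf (V, \<rho>', P'))"
    by auto
  have "step (V, \<rho>', Par Q P) \<mu> s (return_pmf (V, \<rho>', Par Q P'))" for \<rho>'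
    using step.intros(13)[OF P'(2) 13(3)] by (simp add: par_left_def)
  then show ?case using P' by (auto simp: par_left_def)
qed (blast intro: step.intros)+

section \<open>Tests on configurations and functionals linear on density operators\<close>

fun entry :: "('c, 't) proc \<Rightarrow> nat \<Rightarrow> nat \<Rightarrow> ('c, 't) conf option \<Rightarrow> complex" where
  "entry R x y None = 0"
| "entry R x y (Some (V, \<rho>, P)) = (if P = R then \<rho> $$ (x, y) else 0)"

text \<open>Explicit coefficients give a linear extension beyond density operators, where
  \<open>F\<close> itself is not controlled; weighted sums of states can then be inserted.\<close>

definition density_linear :: "qubit set \<Rightarrow> (complex mat \<Rightarrow> complex) \<Rightarrow> bool" where
  "density_linear V F \<longleftrightarrow> (\<exists>c. \<forall>\<rho>. density_op V \<rho> \<longrightarrow>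
     F \<rho> = (\<Sum>a<2 ^ card V. \<Sum>b<2 ^ card V. c a b * \<rho> $$ (a, b)))"

lemma density_linear_cong:
  "density_linear V F \<Longrightarrow> (\<And>\<rho>. density_op V \<rho> \<Longrightarrow> G \<rho> = F \<rho>) \<Longrightarrow> density_linear V G"
  by (simp add: density_linear_def)

lemma density_linear_zero: "density_linear V (\<lambda>\<rho>. 0)"
  unfolding density_linear_def by (intro exI[of _ "\<lambda>_ _. 0"]) simp

lemma density_linear_entry:
  assumes "x < 2 ^ card V" "y < 2 ^ card V"
  shows "density_linear V (\<lambda>\<rho>. \<rho> $$ (x, y))"
  unfolding density_linear_def
proof (intro exI allI impI)
  fix \<rho> :: "complex mat"
  have "(\<Sum>a<2 ^ card V. \<Sum>b<2 ^ card V. of_bool (a = x \<and> b = y) * \<rho> $$ (a, b))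
    = (\<Sum>a\<in>{x}. \<Sum>b\<in>{y}. \<rho> $$ (a, b))"
    using assms by (intro sum.mono_neutral_cong_right ballI)
      (auto intro!: sum.neutral sum.mono_neutral_cong_right)
  then show "\<rho> $$ (x, y) =
      (\<Sum>a<2 ^ card V. \<Sum>b<2 ^ card V. of_bool (a = x \<and> b = y) * \<rho> $$ (a, b))"
    by simp
qed

lemma density_linear_sum:
  assumes "\<And>i. i \<in> I \<Longrightarrow> density_linear V (F i)"
  shows "density_linear V (\<lambda>\<rho>. \<Sum>i\<in>I. F i \<rho>)"
proof -
  define c where "c i = (SOME c. \<forall>\<rho>. density_op V \<rho> \<longrightarrow>
    F i \<rho> = (\<Sum>a<2 ^ card V. \<Sum>b<2 ^ card V. c a b * \<rho> $$ (a, b)))" for i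
  have c: "F i \<rho> = (\<Sum>a<2 ^ card V. \<Sum>b<2 ^ card V. c i a b * \<rho> $$ (a, b))"
    if "i \<in> I" "density_op V \<rho>" for i \<rho>
    using someI_ex[OF assms[OF that(1), unfolded density_linear_def]] that(2) unfolding c_def by blast
  have "(\<Sum>i\<in>I. F i \<rho>) = (\<Sum>a<2 ^ card V. \<Sum>b<2 ^ card V. (\<Sum>i\<in>I. c i a b) * \<rho> $$ (a, b))"
    if "density_op V \<rho>" for \<rho>
  proof -
    have "(\<Sum>i\<in>I. F i \<rho>) = (\<Sum>a<2 ^ card V. \<Sum>i\<in>I. \<Sum>b<2 ^ card V. c i a b * \<rho> $$ (a, b))"
      using c that by (subst sum.swap) simp
    also have "\<dots> = (\<Sum>a<2 ^ card V. \<Sum>b<2 ^ card V. \<Sum>i\<in>I. c i a b * \<rho> $$ (a, b))"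
      by (intro sum.cong refl sum.swap)
    finally show ?thesis by (simp add: sum_distrib_right)
  qed
  then show ?thesis
    unfolding density_linear_def by (intro exI allI impI)
qed

lemma density_linear_scale: "density_linear V F \<Longrightarrow> density_linear V (\<lambda>\<rho>. k * F \<rho>)"
  unfolding density_linear_def
  by (elim exE, rule_tac x = "\<lambda>a b. k * c a b" in exI) (simp add: sum_distrib_left mult.assoc)

text \<open>A density operator has trace 1, so a constant is that constant times the trace. Needed
  for the deadlock, which a blocked process reaches from every state.\<close>

lemma density_linear_const: "density_linear V (\<lambda>\<rho>. k)"
proof -
  have "density_linear V (\<lambda>\<rho>. k * (\<Sum>x<2 ^ card V. \<rho> $$ (x, x)))"
    by (intro density_linear_scale density_linear_sum density_linear_entry) auto
  moreover have "(\<Sum>x<2 ^ card V. \<rho> $$ (x, x)) = 1" if "density_op V \<rho>" for \<rho>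
    using that tr_eq by (metis density_op_def)
  ultimately show ?thesis by (elim density_linear_cong) simp
qed

lemma density_linear_sandwich:
  assumes "A \<in> carrier_mat (2 ^ card V) (2 ^ card V)" "x < 2 ^ card V" "y < 2 ^ card V"
  shows "density_linear V (\<lambda>\<rho>. (A * \<rho> * mat_adjoint A) $$ (x, y))"
proof -
  have "density_linear V (\<lambda>\<rho>. \<Sum>a<2 ^ card V. \<Sum>b<2 ^ card V. A $$ (x, a) * cnj (A $$ (y, b)) * \<rho> $$ (a, b))"
    by (intro density_linear_scale density_linear_sum density_linear_entry) auto
  then show ?thesis
    by (rule density_linear_cong)
       (auto simp: density_op_def index_sandwich[OF assms(1) _ assms(2,3)] mult_ac simp del: index_mult_mat)
qed

lemma density_linear_app_op:
  assumes "x < 2 ^ card V" "y < 2 ^ card V"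
  shows "density_linear V (\<lambda>\<rho>. app_op V qs E \<rho> $$ (x, y))"
proof -
  let ?K = "\<lambda>i. ext_op V qs (kraus_of E ! i)"
  have "density_linear V (\<lambda>\<rho>. \<Sum>i<length (kraus_of E). (?K i * \<rho> * mat_adjoint (?K i)) $$ (x, y))"
    by (intro density_linear_sum density_linear_sandwich ext_op_carrier assms)
  then show ?thesis
    by (rule density_linear_cong)
       (use assms in \<open>auto simp: app_op_def kraus_map_def mat_sum_def simp del: index_mult_mat intro!: sum.cong\<close>)
qed

text \<open>\<open>D \<rho>\<close> itself is not linear: probabilities and normalised results both
  vary with the state. Only the expectation of each test is, where a test picks out one target
  process.\<close>

definition linear_steps ::
  "qubit set \<Rightarrow> ('c, 't) proc \<Rightarrow> 't sched \<Rightarrow> (complex mat \<Rightarrow> ('c, 't) conf pmf) \<Rightarrow> bool" where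
  "linear_steps V P s D \<longleftrightarrow>
     (\<forall>\<rho>. density_op V \<rho> \<longrightarrow> step (V, \<rho>, P) Silent s (D \<rho>) \<and> finite (set_pmf (D \<rho>))) \<and>
     (\<forall>R x y. x < 2 ^ card V \<longrightarrow> y < 2 ^ card V \<longrightarrow>
       density_linear V (\<lambda>\<rho>. expct (D \<rho>) (\<lambda>C. entry R x y (Some C))))"

lemma linear_steps_return:
  assumes "\<And>\<rho>. density_op V \<rho> \<Longrightarrow> step (V, \<rho>, P) Silent s (return_pmf (V, f \<rho>, P'))"
    and "\<And>x y. x < 2 ^ card V \<Longrightarrow> y < 2 ^ card V \<Longrightarrow> density_linear V (\<lambda>\<rho>. f \<rho> $$ (x, y))"
  shows "linear_steps V P s (\<lambda>\<rho>. return_pmf (V, f \<rho>, P'))"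
proof -
  have "density_linear V (\<lambda>\<rho>. if P' = R then f \<rho> $$ (x, y) else 0)"
    if "x < 2 ^ card V" "y < 2 ^ card V" for x y R
    using that assms(2) density_linear_zero by (cases "P' = R") auto
  then show ?thesis using assms(1) by (simp add: linear_steps_def)
qed

text \<open>Restriction and parallel composition wrap the process by an injective \<open>g\<close>.
  A test for \<open>R\<close> pulls back to a test for the unique preimage of \<open>R\<close>, or
  to 0 if there is none.\<close>

lemma linear_steps_map:
  assumes D: "linear_steps V P s D" and g: "inj g"
    and f: "\<And>V \<rho> P. f (V, \<rho>, P) = (V, \<rho>, g P)"
    and step: "\<And>\<rho> \<Delta>. step (V, \<rho>, P) Silent s \<Delta> \<Longrightarrow> step (V, \<rho>, P') Silent s (map_pmf f \<Delta>)"
  shows "linear_steps V P' s (\<lambda>\<rho>. map_pmf f (D \<rho>))"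
proof -
  have "density_linear V (\<lambda>\<rho>. expct (map_pmf f (D \<rho>)) (\<lambda>C. entry R x y (Some C)))"
    if xy: "x < 2 ^ card V" "y < 2 ^ card V" for R x y
  proof (cases "R \<in> range g")
    case True
    then obtain R' where R': "R = g R'" by blast
    have "entry R x y (Some (f C)) = entry R' x y (Some C)" for C
      using g by (cases C) (auto simp: f R' inj_eq)
    then have "expct (map_pmf f (D \<rho>)) (\<lambda>C. entry R x y (Some C)) = expct (D \<rho>) (\<lambda>C. entry R' x y (Some C))"
      if "density_op V \<rho>" for \<rho>
      using D that by (simp add: linear_steps_def expct_map)
    moreover have "density_linear V (\<lambda>\<rho>. expct (D \<rho>) (\<lambda>C. entry R' x y (Some C)))"
      using D xy by (simp add: linear_steps_def)
    ultimately show ?thesis by (elim density_linear_cong)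
  next
    case False
    then have "entry R x y (Some (f C)) = 0" for C by (cases C) (auto simp: f)
    then have "expct (map_pmf f (D \<rho>)) (\<lambda>C. entry R x y (Some C)) = 0" if "density_op V \<rho>" for \<rho>
      using D that by (simp add: linear_steps_def expct_map)
    then show ?thesis by (rule density_linear_cong[OF density_linear_zero])
  qed
  then show ?thesis using D step by (auto simp: linear_steps_def)
qed

lemma linear_steps_mono:
  assumes "linear_steps V P s D" "\<And>\<rho> \<Delta>. step (V, \<rho>, P) Silent s \<Delta> \<Longrightarrow> step (V, \<rho>, P') Silent s \<Delta>"
  shows "linear_steps V P' s D"
  using assms by (simp add: linear_steps_def)

lemma linear_steps_meas:
  assumes q: "distinct qs" "set qs \<subseteq> V" "length qs = meas_arity M"
  shows "\<exists>D. linear_steps V (Meas t M (map qb qs) y P) (Single t) D"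
proof
  let ?p = "\<lambda>\<rho> m. Re (tr (app_meas V qs M m \<rho>))"
  let ?N = "\<lambda>\<rho> m. (V, complex_of_real (1 / ?p \<rho> m) \<cdot>\<^sub>m app_meas V qs M m \<rho>, subst y (VNat m) P)"
  let ?D = "\<lambda>\<rho>. mix (outcomes M) (?p \<rho>) (\<lambda>m. return_pmf (?N \<rho> m))"
  have valid: "finite (outcomes M)" "\<And>m. 0 \<le> ?p \<rho> m" "sum (?p \<rho>) (outcomes M) = 1"
    if "density_op V \<rho>" for \<rho>
    using measurement_complete(1) app_meas_tr(1)[OF that] app_meas_tr_sum[OF that q] by auto
  have "finite (set_pmf (?D \<rho>))" if "density_op V \<rho>" for \<rho>
    by (subst set_pmf_mix[OF valid[OF that]]) (simp add: measurement_complete(1))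
  moreover have "density_linear V (\<lambda>\<rho>. expct (?D \<rho>) (\<lambda>C. entry R a b (Some C)))"
    if ab: "a < 2 ^ card V" "b < 2 ^ card V" for R a b
  proof -
    \<comment> \<open>Several outcomes can lead to the same process, for instance when
      \<open>y\<close> is not free in \<open>P\<close>, so the test for \<open>R\<close> collects
      all of them.\<close>
    have "density_linear V (\<lambda>\<rho>. \<Sum>m\<in>{m \<in> outcomes M. subst y (VNat m) P = R}. app_meas V qs M m \<rho> $$ (a, b))"
      unfolding app_meas_def by (intro density_linear_sum density_linear_sandwich ext_op_carrier ab)
    then show ?thesis
    proof (rule density_linear_cong)
      fix \<rho> assume \<rho>: "density_op V \<rho>"
      have "complex_of_real (?p \<rho> m) * entry R a b (Some (?N \<rho> m)) =
          (if subst y (VNat m) P = R then app_meas V qs M m \<rho> $$ (a, b) else 0)" for m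
      proof (cases "?p \<rho> m = 0")
        case True
        then have "tr (app_meas V qs M m \<rho>) = 0" by (subst app_meas_tr(2)[OF \<rho>]) simp
        then have "app_meas V qs M m \<rho> $$ (a, b) = 0" by (rule psd_tr_0[OF app_meas_psd[OF \<rho>] _ ab])
        with True show ?thesis by simp
      next
        case False
        have "app_meas V qs M m \<rho> \<in> carrier_mat (2 ^ card V) (2 ^ card V)"
          using app_meas_psd[OF \<rho>] by (simp add: psd_def)
        with False ab show ?thesis by simp
      qed
      then show "expct (?D \<rho>) (\<lambda>C. entry R a b (Some C)) =
          (\<Sum>m\<in>{m \<in> outcomes M. subst y (VNat m) P = R}. app_meas V qs M m \<rho> $$ (a, b))"
        by (subst expct_mix[OF valid[OF \<rho>]])
           (simp_all only: expct_return sum.inter_filter measurement_complete(1) set_return_pmf finite.intros)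
    qed
  qed
  moreover have "step (V, \<rho>, Meas t M (map qb qs) y P) Silent (Single t) (?D \<rho>)" for \<rho>
    by (rule step.intros(6)) (rule refl)
  ultimately show "linear_steps V (Meas t M (map qb qs) y P) (Single t) ?D"
    unfolding linear_steps_def by blast
qed

text \<open>No rule consults the operator to decide whether a process can move, so a derivation for
  one state is replayed for all. Typing enters at measurements: distinct qubits inside
  \<open>V\<close> make the probabilities sum to 1, without which \<open>mix\<close> is unspecified.
  Communications go through \<open>step_visible\<close> instead of the induction hypotheses.\<close>

lemma step_linear_steps:
  assumes "step (V, \<rho>, P) \<mu> s \<Delta>" "\<mu> = Silent" "typed S P" "S \<subseteq> qb ` V"
  shows "\<exists>D. linear_steps V P s D"
  using assms
proof (induction "(V, \<rho>, P)" \<mu> s \<Delta> arbitrary: P S rule: step.induct)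
  case (1 t P)
  have "linear_steps V (Tau t P) (Single t) (\<lambda>\<rho>. return_pmf (V, \<rho>, P))"
    by (intro linear_steps_return step.intros density_linear_entry)
  then show ?case by blast
next
  case (2 t t' P)
  have "linear_steps V (TauPair t t' P) (Double t t') (\<lambda>\<rho>. return_pmf (V, \<rho>, P))"
    by (intro linear_steps_return step.intros density_linear_entry)
  then show ?case by blast
next
  case (5 t E qs P)
  have "linear_steps V (Op t E (map qb qs) P) (Single t) (\<lambda>\<rho>. return_pmf (V, app_op V qs E \<rho>, P))"
    by (intro linear_steps_return step.intros density_linear_app_op)
  then show ?case by blast
next
  case (6 p qs M t y P)
  have t: "distinct (map qb qs)" "set (map qb qs) \<subseteq> S" "length qs = meas_arity M"
    using 6(3) by (auto elim!: typed_MeasE simp del: set_map)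
  show ?case by (rule linear_steps_meas[OF map_qb[OF t(1,2) 6(4)] t(3)])
next
  case (7 e P \<mu> s \<Delta> Q)
  have t: "typed S P" using 7(5) by (auto elim: typed_CondE)
  obtain D where "linear_steps V P s D" using 7(3)[OF 7(4) t 7(6)] by blast
  then have "linear_steps V (Cond e P Q) s D" by (rule linear_steps_mono) (rule step.intros(7)[OF 7(1)])
  then show ?case by blast
next
  case (8 e Q \<mu> s \<Delta> P)
  have t: "typed S Q" using 8(5) by (auto elim: typed_CondE)
  obtain D where "linear_steps V Q s D" using 8(3)[OF 8(4) t 8(6)] by blast
  then have "linear_steps V (Cond e P Q) s D" by (rule linear_steps_mono) (rule step.intros(8)[OF 8(1)])
  then show ?case by blast
next
  case (9 P \<mu> s \<Delta> Q)
  have t: "typed S P" using 9(4) by (auto elim: typed_ChoiceE)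
  obtain D where "linear_steps V P s D" using 9(2)[OF 9(3) t 9(5)] by blast
  then have "linear_steps V (Choice P Q) s D" by (rule linear_steps_mono) (rule step.intros(9))
  then show ?case by blast
next
  case (10 Q \<mu> s \<Delta> P)
  have t: "typed S Q" using 10(4) by (auto elim: typed_ChoiceE)
  obtain D where "linear_steps V Q s D" using 10(2)[OF 10(3) t 10(5)] by blast
  then have "linear_steps V (Choice P Q) s D" by (rule linear_steps_mono) (rule step.intros(10))
  then show ?case by blast
next
  case (11 P \<mu> s \<Delta> c)
  have t: "typed S P" using 11(5) by (auto elim: typed_ResE)
  obtain D where D: "linear_steps V P s D" using 11(2)[OF 11(4) t 11(6)] by blast
  have st: "step (V, \<rho>, Res P c) Silent s (map_pmf (restrict_conf c) \<Delta>)"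
    if "step (V, \<rho>, P) Silent s \<Delta>" for \<rho> \<Delta>
    by (rule step.intros(11)[OF that]) simp
  have "linear_steps V (Res P c) s (\<lambda>\<rho>. map_pmf (restrict_conf c) (D \<rho>))"
    by (rule linear_steps_map[OF D _ _ st, where g = "\<lambda>P. Res P c"]) (simp_all add: inj_def restrict_conf_def)
  then show ?case by blast
next
  case (12 P \<mu> s \<Delta> Q)
  obtain S' where t: "typed S' P" "S' \<subseteq> qb ` V" using 12(5,6) by (auto elim!: typed_ParE)
  obtain D where D: "linear_steps V P s D" using 12(2)[OF 12(4) t(1) t(2)] by blast
  have st: "step (V, \<rho>, Par P Q) Silent s (map_pmf (par_right Q) \<Delta>)"
    if "step (V, \<rho>, P) Silent s \<Delta>" for \<rho> \<Delta>
    by (rule step.intros(12)[OF that]) simp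
  have "linear_steps V (Par P Q) s (\<lambda>\<rho>. map_pmf (par_right Q) (D \<rho>))"
    by (rule linear_steps_map[OF D _ _ st, where g = "\<lambda>P. Par P Q"]) (simp_all add: inj_def par_right_def)
  then show ?case by blast
next
  case (13 P \<mu> s \<Delta> Q)
  obtain S' where t: "typed S' P" "S' \<subseteq> qb ` V" using 13(5,6) by (auto elim!: typed_ParE)
  obtain D where D: "linear_steps V P s D" using 13(2)[OF 13(4) t(1) t(2)] by blast
  have st: "step (V, \<rho>, Par Q P) Silent s (map_pmf (par_left Q) \<Delta>)"
    if "step (V, \<rho>, P) Silent s \<Delta>" for \<rho> \<Delta>
    by (rule step.intros(13)[OF that]) simp
  have "linear_steps V (Par Q P) s (\<lambda>\<rho>. map_pmf (par_left Q) (D \<rho>))"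
    by (rule linear_steps_map[OF D _ _ st, where g = "\<lambda>P. Par Q P"]) (simp_all add: inj_def par_left_def)
  then show ?case by blast
next
  case (14 P c v t P' Q t' Q')
  have st: "step (V, \<rho>', P) (Output c v) (Single t) (return_pmf (V, \<rho>', P'))"
    "step (V, \<rho>', Q) (Input c v) (Single t') (return_pmf (V, \<rho>', Q'))" for \<rho>'
    using step_visible[OF 14(1)] step_visible[OF 14(3)] by simp_all
  have "linear_steps V (Par P Q) (Double t t') (\<lambda>\<rho>. return_pmf (V, \<rho>, Par P' Q'))"
    by (rule linear_steps_return[OF step.intros(14)[OF st] density_linear_entry])
  then show ?case by blast
next
  case (15 P c v t P' Q t' Q')
  have st: "step (V, \<rho>', P) (Output c v) (Single t) (return_pmf (V, \<rho>', P'))"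
    "step (V, \<rho>', Q) (Input c v) (Single t') (return_pmf (V, \<rho>', Q'))" for \<rho>'
    using step_visible[OF 15(1)] step_visible[OF 15(3)] by simp_all
  have "linear_steps V (Par Q P) (Double t t') (\<lambda>\<rho>. return_pmf (V, \<rho>, Par Q' P'))"
    by (rule linear_steps_return[OF step.intros(15)[OF st] density_linear_entry])
  then show ?case by blast
qed auto

subsection \<open>The bisimulation\<close>

lemma step_rand_bind:
  assumes "finite (set_pmf \<delta>)" "\<And>s. s \<in> set_pmf \<delta> \<Longrightarrow> step_bot C \<mu> s (g s)"
  shows "step_rand C \<mu> \<delta> (bind_pmf \<delta> g)"
proof -
  obtain f and n :: nat where f: "bij_betw f {0..<n} (set_pmf \<delta>)"
    using ex_bij_betw_nat_finite[OF assms(1)] by blast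
  have "step_rand C \<mu> (mix {0..<n} (\<lambda>i. pmf \<delta> (f i)) (\<lambda>i. return_pmf (f i)))
      (mix {0..<n} (\<lambda>i. pmf \<delta> (f i)) (\<lambda>i. g (f i)))"
    using bij_betwE[OF f] mix_enum(2)[OF f]
    by (intro step_rand.intros assms(2)) (auto intro: pmf_positive)
  then show ?thesis
    using mix_enum(1)[OF f, of return_pmf] mix_enum(1)[OF f, of g] by (simp add: bind_return_pmf')
qed

lemma step_dist_bind:
  assumes "finite (set_pmf \<Delta>)" "\<And>C. C \<in> set_pmf \<Delta> \<Longrightarrow> step_rand C \<mu> \<delta> (G C)"
  shows "step_dist \<Delta> \<mu> \<delta> (bind_pmf \<Delta> G)"
proof -
  obtain f and n :: nat where f: "bij_betw f {0..<n} (set_pmf \<Delta>)"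
    using ex_bij_betw_nat_finite[OF assms(1)] by blast
  have "step_dist (mix {0..<n} (\<lambda>i. pmf \<Delta> (f i)) (\<lambda>i. return_pmf (f i))) \<mu> \<delta>
      (mix {0..<n} (\<lambda>i. pmf \<Delta> (f i)) (\<lambda>i. G (f i)))"
    using bij_betwE[OF f] mix_enum(2)[OF f]
    by (intro step_dist.intros assms(2)) (auto intro: pmf_positive)
  then show ?thesis
    using mix_enum(1)[OF f, of return_pmf] mix_enum(1)[OF f, of G] by (simp add: bind_return_pmf')
qed

lemma step_rand_finite_sched:
  assumes "step_rand C \<mu> \<delta> \<Theta>"
  shows "finite (set_pmf \<delta>)"
  using assms by cases (simp add: set_pmf_mix less_imp_le)

lemma step_dist_finite_sched:
  assumes "step_dist \<Delta> \<mu> \<delta> \<Theta>"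
  shows "finite (set_pmf \<delta>)"
  using assms
proof cases
  case (1 I p C D)
  \<comment> \<open>The weights sum to 1, so some component exists and supplies the
    finiteness.\<close>
  then have "I \<noteq> {}" by auto
  then show ?thesis using 1 step_rand_finite_sched by fast
qed

text \<open>The expectation of \<open>entry R x y\<close> is an entry of the unnormalised state of
  \<open>R\<close>; the inserted function measures the probability of deadlock. The bounds keep the
  indices inside the matrices of the register.\<close>

definition obs :: "qubit set \<Rightarrow> (('c, 't) conf option \<Rightarrow> complex) set" where
  "obs V = insert (\<lambda>C. of_bool (C = None))
     {entry R x y | R x y. x < 2 ^ card V \<and> y < 2 ^ card V}"

text \<open>For a fixed process and scheduler, either all density operators admit a transition or
  none does, so the case split is on the existence of any operator with a transition. In the blocked
  case every test has a constant value.\<close>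

lemma step_bot_linear:
  assumes P: "typed (qb ` W) P" "W \<subseteq> V"
  shows "\<exists>D. (\<forall>\<rho>. density_op V \<rho> \<longrightarrow> step_bot (Some (V, \<rho>, P)) Silent s (D \<rho>)) \<and>
    (\<forall>h\<in>obs V. density_linear V (\<lambda>\<rho>. expct (D \<rho>) h))"
proof (cases "\<exists>\<rho> \<Delta>. step (V, \<rho>, P) Silent s \<Delta>")
  case True
  then obtain D where D: "linear_steps V P s D"
    using step_linear_steps[OF _ refl P(1) image_mono[OF P(2)]] by blast
  have "density_linear V (\<lambda>\<rho>. expct (map_pmf Some (D \<rho>)) h)" if "h \<in> obs V" for h
  proof -
    have "density_linear V (\<lambda>\<rho>. expct (D \<rho>) (\<lambda>C. h (Some C)))"
      using that D density_linear_zero by (auto simp: obs_def linear_steps_def)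
    then show ?thesis
      by (rule density_linear_cong) (use D in \<open>simp add: linear_steps_def expct_map\<close>)
  qed
  then show ?thesis using D
    by (intro exI[of _ "\<lambda>\<rho>. map_pmf Some (D \<rho>)"]) (auto simp: linear_steps_def intro: step_bot.intros)
next
  case False
  then show ?thesis
    by (intro exI[of _ "\<lambda>\<rho>. return_pmf None"]) (auto intro: step_bot.intros density_linear_const)
qed

lemma step_bot_typed:
  assumes "step_bot C Silent s \<Theta>" "conf_typed V W C"
  shows "dist_typed V W \<Theta>"
  using assms(1)
proof cases
  case (1 C' \<Delta>)
  obtain V' \<rho> P where C': "C' = (V', \<rho>, P)" by (cases C')
  then have t: "V' = V" "density_op V \<rho>" "fv P = {}" "typed (qb ` W) P" "W \<subseteq> V"
    using assms(2) 1 by (auto simp: closed_proc_def)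
  have "finite (set_pmf \<Delta>)" and out: "\<And>V' \<rho>' R. (V', \<rho>', R) \<in> set_pmf \<Delta> \<Longrightarrow>
      V' = V \<and> density_op V \<rho>' \<and> fv R = {} \<and> typed (qb ` W) R"
    using step_type[OF 1(3)[unfolded C' t(1)] t(4) image_mono[OF t(5)] t(2,3)] by auto
  moreover have "conf_typed V W (Some C)" if "C \<in> set_pmf \<Delta>" for C
    using that out t(5) by (cases C) (auto simp: closed_proc_def)
  ultimately show ?thesis
    using 1(2) by (auto simp: dist_typed_def)
qed (auto simp: dist_typed_def)

definition obs_equiv :: "qubit set \<Rightarrow> ('c, 't) dist \<Rightarrow> ('c, 't) dist \<Rightarrow> bool" where
  "obs_equiv V \<Delta> \<Theta> \<longleftrightarrow> (\<forall>h\<in>obs V. expct \<Delta> h = expct \<Theta> h)"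

text \<open>On the two finite supports \<open>k\<close> coincides with a finite linear combination
  of tests: one coefficient family for each process that occurs, plus a multiple of the deadlock
  test.\<close>

lemma obs_equiv_linear:
  assumes eq: "obs_equiv V \<Delta> \<Theta>" and typed: "dist_typed V W \<Delta>" "dist_typed V W \<Theta>"
    and k: "\<And>P. typed (qb ` W) P \<Longrightarrow> W \<subseteq> V \<Longrightarrow> density_linear V (\<lambda>\<rho>. k (Some (V, \<rho>, P)))"
  shows "expct \<Delta> k = expct \<Theta> k"
proof -
  let ?d = "2 ^ card V :: nat"
  define c where "c P = (SOME c. \<forall>\<rho>. density_op V \<rho> \<longrightarrow>
    k (Some (V, \<rho>, P)) = (\<Sum>a<?d. \<Sum>b<?d. c a b * \<rho> $$ (a, b)))" for P
  have c: "k (Some (V, \<rho>, P)) = (\<Sum>a<?d. \<Sum>b<?d. c P a b * \<rho> $$ (a, b))"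
    if "typed (qb ` W) P" "W \<subseteq> V" "density_op V \<rho>" for P \<rho>
    using someI_ex[OF k[OF that(1,2), unfolded density_linear_def]] that(3) unfolding c_def by blast
  let ?A = "set_pmf \<Delta> \<union> set_pmf \<Theta>"
  \<comment> \<open>At the deadlock, \<open>the None\<close> adds an arbitrary process to
    \<open>B\<close>; its tests vanish on all configurations that run another process.\<close>
  define B where "B = (\<lambda>C. snd (snd (the C))) ` ?A"
  have A: "finite ?A" "\<And>C. C \<in> ?A \<Longrightarrow> conf_typed V W C"
    using typed by (auto simp: dist_typed_def)
  then have B: "finite B" by (simp add: B_def)
  let ?k = "\<lambda>C. k None * of_bool (C = None) + (\<Sum>P\<in>B. \<Sum>a<?d. \<Sum>b<?d. c P a b * entry P a b C)"
  have k_eq: "k C = ?k C" if C: "C \<in> ?A" for C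
  proof (cases C)
    case (Some C')
    obtain V' \<rho> P where "C' = (V', \<rho>, P)" by (cases C')
    with Some A(2)[OF C] have C': "C = Some (V, \<rho>, P)" and t: "density_op V \<rho>" "typed (qb ` W) P" "W \<subseteq> V"
      by auto
    have "P \<in> B" using C C' unfolding B_def by force
    have "entry R a b C = (if R = P then \<rho> $$ (a, b) else 0)" for R a b
      by (auto simp: C')
    then have "(\<Sum>R\<in>B. \<Sum>a<?d. \<Sum>b<?d. c R a b * entry R a b C) =
        (\<Sum>R\<in>B. if R = P then \<Sum>a<?d. \<Sum>b<?d. c R a b * \<rho> $$ (a, b) else 0)"
      by (intro sum.cong) simp_all
    also have "\<dots> = (\<Sum>a<?d. \<Sum>b<?d. c P a b * \<rho> $$ (a, b))"
      using B \<open>P \<in> B\<close> by simp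
    finally show ?thesis using c[OF t(2,3,1)] by (simp add: C')
  qed simp
  have lin: "expct M ?k = k None * expct M (\<lambda>C. of_bool (C = None)) +
      (\<Sum>P\<in>B. \<Sum>a<?d. \<Sum>b<?d. c P a b * expct M (entry P a b))" for M
    by (simp add: expct_add expct_sum expct_scale)
  have "expct \<Delta> k = expct \<Delta> ?k" "expct \<Theta> k = expct \<Theta> ?k"
    using k_eq by (auto intro!: expct_cong)
  moreover have "expct \<Delta> ?k = expct \<Theta> ?k"
  proof -
    have "expct \<Delta> (\<lambda>C. of_bool (C = None)) = expct \<Theta> (\<lambda>C. of_bool (C = None))"
      using eq by (simp add: obs_equiv_def obs_def)
    moreover have "expct \<Delta> (entry P a b) = expct \<Theta> (entry P a b)" if "a < ?d" "b < ?d" for P a b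
      using eq that unfolding obs_equiv_def obs_def by blast
    ultimately show ?thesis unfolding lin by simp
  qed
  ultimately show ?thesis by simp
qed

lemma obs_equiv_mass:
  fixes \<Delta> \<Theta> :: "('c, 't) dist"
  assumes eq: "obs_equiv V \<Delta> \<Theta>" and fin: "finite (set_pmf \<Delta>)" "finite (set_pmf \<Theta>)"
  shows "mass \<Delta> = mass \<Theta>"
proof -
  have "expct M (\<lambda>C. of_bool (C = None)) = complex_of_real (pmf M None)"
    if "finite (set_pmf M)" for M :: "('c, 't) dist"
  proof -
    have "expct M (\<lambda>C. of_bool (C = None)) = (\<Sum>C\<in>set_pmf M \<inter> {None}. complex_of_real (pmf M C))"
      unfolding expct_def using that by (intro sum.mono_neutral_cong_right) auto
    then show ?thesis by (cases "None \<in> set_pmf M") (auto simp: set_pmf_iff)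
  qed
  then show ?thesis using assms by (simp add: obs_equiv_def obs_def mass_def)
qed

text \<open>\<open>Par R' Q\<close> determines \<open>R'\<close>, so a test composed with plugging
  is again a test, or 0 if its process does not have this shape.\<close>

lemma obs_equiv_plug:
  fixes \<Delta> \<Theta> :: "('c, 't) dist"
  assumes eq: "obs_equiv V \<Delta> \<Theta>" and fin: "finite (set_pmf \<Delta>)" "finite (set_pmf \<Theta>)"
  shows "obs_equiv V (plug Q \<Delta>) (plug Q \<Theta>)"
  unfolding obs_equiv_def
proof
  fix h :: "('c, 't) conf option \<Rightarrow> complex" assume h: "h \<in> obs V"
  have "(\<lambda>C. h (map_option (par_right Q) C)) \<in> insert (\<lambda>C. 0) (obs V)"
  proof (cases "h = (\<lambda>C. of_bool (C = None))")
    case False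
    then obtain R x y where R: "h = entry R x y" "x < 2 ^ card V" "y < 2 ^ card V"
      using h by (auto simp: obs_def)
    show ?thesis
    proof (cases "\<exists>R'. R = Par R' Q")
      case True
      then obtain R' where R': "R = Par R' Q" by blast
      have "h (map_option (par_right Q) C) = entry R' x y C" for C
        unfolding R(1) R' by (cases "(R', x, y, C)" rule: entry.cases) (auto simp: par_right_def)
      then show ?thesis using R by (auto simp: obs_def)
    next
      case False
      have "h (map_option (par_right Q) C) = 0" for C
        unfolding R(1) using False
        by (cases "(R, x, y, C)" rule: entry.cases) (auto simp: par_right_def)
      then show ?thesis by simp
    qed
  qed (simp add: obs_def)
  then show "expct (plug Q \<Delta>) h = expct (plug Q \<Theta>) h"
    using eq fin by (auto simp: plug_def expct_map obs_equiv_def)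
qed

lemma dist_typed_plug:
  assumes "dist_typed V W \<Delta>" "ctx_typed V' W Q" "V' \<subseteq> V"
  shows "dist_typed V V' (plug Q \<Delta>)"
proof -
  have "conf_typed V V' (map_option (par_right Q) C)" if "conf_typed V W C" for C
  proof (cases C)
    case (Some C')
    obtain U \<rho> P where C': "C' = (U, \<rho>, P)" by (cases C')
    have "typed (qb ` W \<union> qb ` (V' - W)) (Par P Q)"
      using that assms(2) Some C' by (intro typed.intros) (auto simp: ctx_typed_def)
    moreover have "qb ` W \<union> qb ` (V' - W) = qb ` V'"
      using assms(2) by (auto simp: ctx_typed_def)
    ultimately show ?thesis
      using that assms Some C' by (auto simp: ctx_typed_def par_right_def closed_proc_def)
  qed simp
  then show ?thesis
    using assms(1) by (auto simp: dist_typed_def plug_def)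
qed

lemma det_tagged_unique:
  "det_tagged \<Delta> \<Longrightarrow> step_dist \<Delta> \<mu> \<delta> \<Delta>' \<Longrightarrow> step_dist \<Delta> \<mu> \<delta> \<Delta>'' \<Longrightarrow> \<Delta>' = \<Delta>''"
  by (erule det_tagged.cases) simp

lemma det_tagged_step:
  "det_tagged \<Delta> \<Longrightarrow> step_dist \<Delta> \<mu> \<delta> \<Delta>' \<Longrightarrow> dist_typed V W \<Delta>' \<Longrightarrow> det_tagged \<Delta>'"
  by (erule det_tagged.cases) simp

lemma obs_equiv_step:
  fixes \<Delta> \<Theta> :: "('c, 't) dist"
  assumes eq: "obs_equiv V \<Delta> \<Theta>" and typed: "dist_typed V W \<Delta>" "dist_typed V W \<Theta>"
    and det: "det_tagged \<Delta>" "det_tagged \<Theta>" and step: "step_dist \<Delta> Silent \<delta> \<Delta>'"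
  shows "\<exists>\<Theta>'. step_dist \<Theta> Silent \<delta> \<Theta>' \<and> det_tagged \<Delta>' \<and> det_tagged \<Theta>' \<and>
    dist_typed V W \<Delta>' \<and> dist_typed V W \<Theta>' \<and> obs_equiv V \<Delta>' \<Theta>'"
proof -
  \<comment> \<open>The choice depends on the process and the scheduler but not on the state;
    otherwise linearity would be lost.\<close>
  define D where "D P s = (SOME D. (\<forall>\<rho>. density_op V \<rho> \<longrightarrow> step_bot (Some (V, \<rho>, P)) Silent s (D \<rho>)) \<and>
    (\<forall>h\<in>obs V. density_linear V (\<lambda>\<rho>. expct (D \<rho>) h)))" for P :: "('c, 't) proc" and s
  have D: "(\<forall>\<rho>. density_op V \<rho> \<longrightarrow> step_bot (Some (V, \<rho>, P)) Silent s (D P s \<rho>)) \<and>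
    (\<forall>h\<in>obs V. density_linear V (\<lambda>\<rho>. expct (D P s \<rho>) h))" if "typed (qb ` W) P" "W \<subseteq> V" for P s
    unfolding D_def by (rule someI_ex[OF step_bot_linear[OF that]])
  define g where "g C s = (case C of None \<Rightarrow> return_pmf None | Some (V', \<rho>, P) \<Rightarrow> D P s \<rho>)"
    for C :: "('c, 't) conf option" and s
  \<comment> \<open>One recipe for both sides: \<open>nxt \<Delta>\<close> and
    \<open>nxt \<Theta>\<close> are built from the same \<open>g\<close>.\<close>
  define nxt where "nxt M = bind_pmf M (\<lambda>C. bind_pmf \<delta> (g C))" for M
  have \<delta>: "finite (set_pmf \<delta>)" by (rule step_dist_finite_sched[OF step])
  have g: "step_bot C Silent s (g C s)" if "conf_typed V W C" for C s
    using that D by (cases "(V, W, C)" rule: conf_typed.cases) (simp_all add: g_def step_bot.intros(3))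
  have g_typed: "dist_typed V W (g C s)" if "conf_typed V W C" for C s
    using step_bot_typed[OF g[OF that] that] .
  have nxt: "step_dist M Silent \<delta> (nxt M)" "dist_typed V W (nxt M)"
    "h \<in> obs V \<Longrightarrow> expct (nxt M) h = expct \<delta> (\<lambda>s. expct M (\<lambda>C. expct (g C s) h))"
    if M: "dist_typed V W M" for M h
  proof -
    have fin: "finite (set_pmf M)" and C: "\<And>C. C \<in> set_pmf M \<Longrightarrow> conf_typed V W C"
      using M by (auto simp: dist_typed_def)
    show "step_dist M Silent \<delta> (nxt M)"
      unfolding nxt_def by (intro step_dist_bind step_rand_bind fin \<delta> g C)
    have g_fin: "finite (set_pmf (g C s))" if "C \<in> set_pmf M" for C s
      using g_typed[OF C[OF that]] by (simp add: dist_typed_def)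
    have "conf_typed V W C'" if "C' \<in> set_pmf (nxt M)" for C'
    proof -
      obtain C s where "C \<in> set_pmf M" "C' \<in> set_pmf (g C s)"
        using \<open>C' \<in> set_pmf (nxt M)\<close> unfolding nxt_def by auto
      then show ?thesis using g_typed[OF C] by (simp add: dist_typed_def)
    qed
    then show "dist_typed V W (nxt M)"
      using g_fin fin \<delta> by (simp add: dist_typed_def nxt_def)
    have "expct (nxt M) h = expct M (\<lambda>C. expct \<delta> (\<lambda>s. expct (g C s) h))"
      unfolding nxt_def using fin \<delta> g_fin
      by (subst expct_bind) (auto intro!: expct_cong expct_bind)
    then show "expct (nxt M) h = expct \<delta> (\<lambda>s. expct M (\<lambda>C. expct (g C s) h))"
      by (subst (asm) expct_swap)
  qed
  have "obs_equiv V (nxt \<Delta>) (nxt \<Theta>)"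
    unfolding obs_equiv_def
  proof
    fix h :: "('c, 't) conf option \<Rightarrow> complex" assume h: "h \<in> obs V"
    \<comment> \<open>With the scheduler fixed, the expected test value is linear in the state for
      each process.\<close>
    have "expct \<Delta> (\<lambda>C. expct (g C s) h) = expct \<Theta> (\<lambda>C. expct (g C s) h)" for s
      by (rule obs_equiv_linear[OF eq typed]) (use D h in \<open>simp add: g_def\<close>)
    then show "expct (nxt \<Delta>) h = expct (nxt \<Theta>) h"
      using nxt(3)[OF typed(1) h] nxt(3)[OF typed(2) h] by simp
  qed
  \<comment> \<open>The given transition may have split \<open>\<Delta>\<close> in any way;
    determinism identifies its result with the assembled one.\<close>
  moreover have "\<Delta>' = nxt \<Delta>"
    by (rule det_tagged_unique[OF det(1) step nxt(1)[OF typed(1)]])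
  moreover have "det_tagged (nxt \<Delta>)" "det_tagged (nxt \<Theta>)"
    using typed by (auto intro: det_tagged_step[OF det(1) nxt(1,2)] det_tagged_step[OF det(2) nxt(1,2)])
  ultimately show ?thesis using nxt(1,2) typed by blast
qed

section \<open>The relation is a saturated bisimulation\<close>

lemma obs_equiv_sym: "obs_equiv V \<Delta> \<Theta> \<Longrightarrow> obs_equiv V \<Theta> \<Delta>"
  by (simp add: obs_equiv_def)

lemma obs_equiv_bisimilar:
  fixes \<Delta> \<Theta> :: "('c, 't) dist"
  assumes "obs_equiv V \<Delta> \<Theta>" "dist_typed V W \<Delta>" "dist_typed V W \<Theta>" "det_tagged \<Delta>" "det_tagged \<Theta>"
  shows "sat_bisimilar \<Delta> \<Theta>"
proof -
  \<comment> \<open>The types are quantified inside \<open>R\<close>, since a context replaces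
    \<open>W\<close> by its own type \<open>V'\<close>.\<close>
  define R where "R \<Delta> \<Theta> \<longleftrightarrow> det_tagged \<Delta> \<and> det_tagged \<Theta> \<and>
    (\<exists>V W. dist_typed V W \<Delta> \<and> dist_typed V W \<Theta> \<and> obs_equiv V \<Delta> \<Theta>)" for \<Delta> \<Theta> :: "('c, 't) dist"
  have R_sym: "R \<Theta> \<Delta>" if "R \<Delta> \<Theta>" for \<Delta> \<Theta>
    using that obs_equiv_sym unfolding R_def by blast
  have R_step: "\<exists>\<Theta>'. step_dist (plug Q \<Theta>) Silent \<delta> \<Theta>' \<and> R \<Delta>' \<Theta>'"
    if "obs_equiv V \<Delta> \<Theta>" "dist_typed V W \<Delta>" "dist_typed V W \<Theta>" "ctx_typed V' W Q" "V' \<subseteq> V"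
      "det_tagged (plug Q \<Delta>)" "det_tagged (plug Q \<Theta>)" "step_dist (plug Q \<Delta>) Silent \<delta> \<Delta>'"
    for V W V' Q \<Delta> \<Theta> \<delta> \<Delta>'
  proof -
    have "obs_equiv V (plug Q \<Delta>) (plug Q \<Theta>)"
      using that(1-3) by (intro obs_equiv_plug) (auto simp: dist_typed_def)
    from obs_equiv_step[OF this dist_typed_plug[OF that(2,4,5)] dist_typed_plug[OF that(3,4,5)] that(6-8)]
    show ?thesis unfolding R_def by blast
  qed
  have "sat_bisim R"
    unfolding sat_bisim_def
  proof (intro allI impI)
    fix \<Delta> \<Theta> assume r: "R \<Delta> \<Theta>"
    then obtain V W where VW: "dist_typed V W \<Delta>" "dist_typed V W \<Theta>" "obs_equiv V \<Delta> \<Theta>"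
      unfolding R_def by blast
    have "det_tagged \<Delta>" "det_tagged \<Theta>" using r unfolding R_def by auto
    moreover have "mass \<Delta> = mass \<Theta>"
      using VW by (intro obs_equiv_mass) (auto simp: dist_typed_def)
    \<comment> \<open>The other direction is the same step with the roles of the two distributions
      exchanged.\<close>
    moreover have "\<exists>\<Delta>'. step_dist (plug Q \<Delta>) Silent \<delta> \<Delta>' \<and> R \<Delta>' \<Theta>'"
      if "ctx_typed V' W Q" "V' \<subseteq> V" "det_tagged (plug Q \<Delta>)" "det_tagged (plug Q \<Theta>)"
        "step_dist (plug Q \<Theta>) Silent \<delta> \<Theta>'" for V' Q \<delta> \<Theta>'
      using R_step[OF obs_equiv_sym[OF VW(3)] VW(2,1) that(1,2,4,3,5)] R_sym by blast
    ultimately show "det_tagged \<Delta> \<and> det_tagged \<Theta> \<and> mass \<Delta> = mass \<Theta> \<and>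
     (\<exists>V W. dist_typed V W \<Delta> \<and> dist_typed V W \<Theta> \<and>
       (\<forall>V' Q \<delta>. ctx_typed V' W Q \<and> V' \<subseteq> V \<and> det_tagged (plug Q \<Delta>) \<and> det_tagged (plug Q \<Theta>) \<longrightarrow>
         (\<forall>\<Delta>'. step_dist (plug Q \<Delta>) Silent \<delta> \<Delta>' \<longrightarrow>
            (\<exists>\<Theta>'. step_dist (plug Q \<Theta>) Silent \<delta> \<Theta>' \<and> R \<Delta>' \<Theta>')) \<and>
         (\<forall>\<Theta>'. step_dist (plug Q \<Theta>) Silent \<delta> \<Theta>' \<longrightarrow>
            (\<exists>\<Delta>'. step_dist (plug Q \<Delta>) Silent \<delta> \<Delta>' \<and> R \<Delta>' \<Theta>'))))"
      using VW R_step[OF VW(3,1,2)] by (intro conjI exI[of _ V] exI[of _ W] allI impI) blast+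
  qed
  moreover have "R \<Delta> \<Theta>" using assms unfolding R_def by blast
  ultimately show ?thesis unfolding sat_bisimilar_def by blast
qed

lemma expct_mix_return:
  assumes "finite I" "\<And>i. i \<in> I \<Longrightarrow> 0 \<le> p i" "sum p I = 1"
  shows "expct (mix I p (\<lambda>i. return_pmf (f i))) h = (\<Sum>i\<in>I. complex_of_real (p i) * h (f i))"
  by (simp add: expct_mix[OF assms])

theorem theorem4:
  fixes P :: "('c, 't) proc"
    and I :: "'i set" and p :: "'i \<Rightarrow> real" and \<rho> :: "'i \<Rightarrow> complex mat"
    and J :: "'j set" and q :: "'j \<Rightarrow> real" and \<sigma> :: "'j \<Rightarrow> complex mat"
    and V W :: "qubit set"
  assumes "closed_proc P" and "typed (qb ` W) P" and "W \<subseteq> V"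
    and "finite I" and "\<And>i. i \<in> I \<Longrightarrow> 0 \<le> p i" and "(\<Sum>i\<in>I. p i) = 1"
    and "finite J" and "\<And>j. j \<in> J \<Longrightarrow> 0 \<le> q j" and "(\<Sum>j\<in>J. q j) = 1"
    and "\<And>i. i \<in> I \<Longrightarrow> density_op V (\<rho> i)" and "\<And>j. j \<in> J \<Longrightarrow> density_op V (\<sigma> j)"
    and "mat_sum (2 ^ card V) (\<lambda>i. complex_of_real (p i) \<cdot>\<^sub>m \<rho> i) I =
         mat_sum (2 ^ card V) (\<lambda>j. complex_of_real (q j) \<cdot>\<^sub>m \<sigma> j) J"
    and "det_tagged (mix I p (\<lambda>i. return_pmf (Some (V, \<rho> i, P))))"
    and "det_tagged (mix J q (\<lambda>j. return_pmf (Some (V, \<sigma> j, P))))"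
  shows "sat_bisimilar (mix I p (\<lambda>i. return_pmf (Some (V, \<rho> i, P))))
                       (mix J q (\<lambda>j. return_pmf (Some (V, \<sigma> j, P))))"
proof -
  let ?\<Delta> = "mix I p (\<lambda>i. return_pmf (Some (V, \<rho> i, P)))"
  let ?\<Theta> = "mix J q (\<lambda>j. return_pmf (Some (V, \<sigma> j, P)))"
  have typed: "dist_typed V W ?\<Delta>" "dist_typed V W ?\<Theta>"
    using assms by (auto simp: dist_typed_def set_pmf_mix)
  have "expct ?\<Delta> (entry R x y) = expct ?\<Theta> (entry R x y)"
    if xy: "x < 2 ^ card V" "y < 2 ^ card V" for R x y
  proof (cases "P = R")
    case True
    have c: "(complex_of_real (p i) \<cdot>\<^sub>m \<rho> i) $$ (x, y) = complex_of_real (p i) * \<rho> i $$ (x, y)" if "i \<in> I" for i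
      using assms(10)[OF that] xy by (auto simp: density_op_def)
    have d: "(complex_of_real (q j) \<cdot>\<^sub>m \<sigma> j) $$ (x, y) = complex_of_real (q j) * \<sigma> j $$ (x, y)" if "j \<in> J" for j
      using assms(11)[OF that] xy by (auto simp: density_op_def)
    \<comment> \<open>The equality of the mixed states, read at one entry.\<close>
    have "(\<Sum>i\<in>I. (complex_of_real (p i) \<cdot>\<^sub>m \<rho> i) $$ (x, y)) = (\<Sum>j\<in>J. (complex_of_real (q j) \<cdot>\<^sub>m \<sigma> j) $$ (x, y))"
      using arg_cong[OF assms(12), of "\<lambda>A. A $$ (x, y)"] xy by (simp add: mat_sum_def)
    then show ?thesis
      using True by (simp add: expct_mix_return[OF assms(4,5,6)] expct_mix_return[OF assms(7,8,9)] c d)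
  qed (simp add: expct_mix_return[OF assms(4,5,6)] expct_mix_return[OF assms(7,8,9)])
  \<comment> \<open>For the remaining test, the deadlock has probability 0 on both sides.\<close>
  then have "obs_equiv V ?\<Delta> ?\<Theta>"
    by (auto simp: obs_equiv_def obs_def expct_mix_return[OF assms(4,5,6)] expct_mix_return[OF assms(7,8,9)])
  from obs_equiv_bisimilar[OF this typed assms(13,14)] show ?thesis .
qed

end
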